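(* Let $\mathcal{M}$ be the monoid of nondecreasing continuous maps from $[0,1]$ to itself preserving the extremities. Let $X$ be a topological space and let $dX$ be a set of continuous maps from $[0,1]$ to $X$ which is invariant under the action of $\mathcal{M}$, i.e. $\gamma\circ\phi\in dX$ for all $\gamma\in dX$ and $\phi\in\mathcal{M}$. Let $\mathcal{D}^{\mathcal{M}}(X,dX)$ be the contravariant diagram of topological spaces over the one-object category $\mathcal{M}$ with only vertex the space $dX$ and taking $\phi\in\mathcal{M}$ to $\phi^*:dX\to dX$, $\gamma\mapsto\gamma\circ\phi$. Then there is a weak homotopy equivalence $$\mathop{\mathrm{hocolim}}\mathcal{D}^{\mathcal{M}}(X,dX)\simeq dX,$$ where the homotopy colimit is calculated in the ordinary (i.e. non-enriched) projective model structure.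
   Context: $\mathbf{Top}$ is the category of $\Delta$-generated spaces, i.e. the full coreflective subcategory of general topological spaces consisting of colimits of topological simplices (no separation axiom is assumed); it is cartesian closed with internal hom $\mathbf{TOP}(-,-)$. "Topological space" means object of $\mathbf{Top}$. The set $dX$ is equipped with its natural topology making the evaluation maps continuous: the $\Delta$-kelleyfication (image under the right adjoint of the inclusion of $\mathbf{Top}$ into general topological spaces) of the initial topology for the inclusion $dX\subset\mathbf{TOP}([0,1],X)$. The monoid $\mathcal{M}$ is viewed here as an ordinary category with one object and set of morphisms $\mathcal{M}$ (no topology on $\mathcal{M}$). The homotopy colimit is that of the functor $\mathcal{D}^{\mathcal{M}}(X,dX):\mathcal{M}^{op}\to\mathbf{Top}$, i.e. the colimit of a cofibrant replacement of it in the projective model structure on the category of all functors $\mathbf{Top}^{\mathcal{M}^{op}}$ (pointwise weak homotopy equivalences and pointwise Serre fibrations, using the Quillen model structure on $\mathbf{Top}$). The symbol $\simeq$ means having the same weak homotopy type. *)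

theory Defs
  imports "HOL-Homology.Homology"
begin

section \<open>\<open>\<Delta>\<close>-generated spaces\<close>

abbreviation simplex_space :: "nat \<Rightarrow> (nat \<Rightarrow> real) topology" where
  "simplex_space p \<equiv> subtopology (powertop_real UNIV) (standard_simplex p)"

text \<open>
  The right adjoint of the inclusion of \<open>\<Delta>\<close>-generated spaces into general topological spaces:
  same points, with the final topology for all continuous maps from topological simplices.
\<close>

definition Delta_kelleyfication :: "'a topology \<Rightarrow> 'a topology" where
  "Delta_kelleyfication X = topology (\<lambda>U. U \<subseteq> topspace X \<and>
     (\<forall>p f. singular_simplex p X f \<longrightarrow>
        openin (simplex_space p) {x \<in> topspace (simplex_space p). f x \<in> U}))"

definition Delta_generated :: "'a topology \<Rightarrow> bool" where
  "Delta_generated X \<longleftrightarrow> Delta_kelleyfication X = X"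

lemma openin_Delta_kelleyfication:
  "openin (Delta_kelleyfication X) U \<longleftrightarrow> U \<subseteq> topspace X \<and>
     (\<forall>p f. singular_simplex p X f \<longrightarrow>
        openin (simplex_space p) {x \<in> topspace (simplex_space p). f x \<in> U})"
proof -
  let ?P = "\<lambda>U. U \<subseteq> topspace X \<and>
     (\<forall>p f. singular_simplex p X f \<longrightarrow>
        openin (simplex_space p) {x \<in> topspace (simplex_space p). f x \<in> U})"
  have "istopology ?P"
    unfolding istopology_def
  proof (intro conjI allI impI)
    fix S T assume S: "?P S" and T: "?P T"
    show "S \<inter> T \<subseteq> topspace X" using S by blast
    fix p f assume f: "singular_simplex p X f"
    have "{x \<in> topspace (simplex_space p). f x \<in> S \<inter> T}
        = {x \<in> topspace (simplex_space p). f x \<in> S} \<inter> {x \<in> topspace (simplex_space p). f x \<in> T}"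
      by blast
    then show "openin (simplex_space p) {x \<in> topspace (simplex_space p). f x \<in> S \<inter> T}"
      using S T f by (simp add: openin_Int)
  next
    fix \<K> assume K: "\<forall>K\<in>\<K>. ?P K"
    show "\<Union>\<K> \<subseteq> topspace X" using K by blast
    fix p f assume f: "singular_simplex p X f"
    have "{x \<in> topspace (simplex_space p). f x \<in> \<Union>\<K>}
        = (\<Union>K\<in>\<K>. {x \<in> topspace (simplex_space p). f x \<in> K})"
      by blast
    also have "openin (simplex_space p) \<dots>"
      using K f by (intro openin_Union) auto
    finally show "openin (simplex_space p) {x \<in> topspace (simplex_space p). f x \<in> \<Union>\<K>}" .
  qed
  then show ?thesis
    unfolding Delta_kelleyfication_def by (simp add: topology_inverse')
qed

lemma openin_imp_openin_Delta_kelleyfication: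
  "openin X U \<Longrightarrow> openin (Delta_kelleyfication X) U"
  unfolding openin_Delta_kelleyfication singular_simplex_def
  by (auto dest: openin_continuous_map_preimage openin_subset)

lemma topspace_Delta_kelleyfication [simp]: "topspace (Delta_kelleyfication X) = topspace X"
  by (metis openin_Delta_kelleyfication openin_imp_openin_Delta_kelleyfication
      openin_topspace openin_subset subset_antisym)

lemma singular_simplex_Delta_kelleyfication:
  "singular_simplex p (Delta_kelleyfication X) f \<longleftrightarrow> singular_simplex p X f"
proof
  assume f: "singular_simplex p (Delta_kelleyfication X) f"
  then show "singular_simplex p X f"
    unfolding singular_simplex_def continuous_map
    by (auto intro: openin_imp_openin_Delta_kelleyfication)
next
  assume f: "singular_simplex p X f"
  then show "singular_simplex p (Delta_kelleyfication X) f"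
    unfolding singular_simplex_def continuous_map
    using f by (auto simp: openin_Delta_kelleyfication)
qed

lemma Delta_generated_Delta_kelleyfication: "Delta_generated (Delta_kelleyfication X)"
  unfolding Delta_generated_def topology_eq
  by (simp add: openin_Delta_kelleyfication [of "Delta_kelleyfication X"]
      singular_simplex_Delta_kelleyfication) (simp add: openin_Delta_kelleyfication)

text \<open>
  The \<open>\<Delta>\<close>-generated spaces are exactly the colimits of simplices: the quotients of disjoint
  unions of simplices. (A quotient of a disjoint union of simplices by an equivalence relation is
  the colimit of a diagram of simplices, the identified pairs of points being indexed by copies of
  the \<open>0\<close>-simplex.)
\<close>

lemma Delta_generated_iff_colimit_of_simplices:
  "Delta_generated X \<longleftrightarrow>
     (\<exists>S. (\<forall>(p, f)\<in>S. singular_simplex p X f) \<and>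
          quotient_map (sum_topology (\<lambda>(p, f). simplex_space p) S) X (\<lambda>((p, f), x). f x))"
  (is "_ \<longleftrightarrow> ?R")
proof
  assume X: "Delta_generated X"
  let ?S = "{(p, f). singular_simplex p X f}"
  have surj: "\<exists>x f p. x \<in> standard_simplex p \<and> singular_simplex p X f \<and> f x = y"
    if y: "y \<in> topspace X" for y
  proof -
    obtain x where x: "x \<in> standard_simplex 0" using nonempty_standard_simplex by blast
    have "singular_simplex 0 X (restrict (\<lambda>_. y) (standard_simplex 0))"
      unfolding singular_simplex_def using y
      by (simp add: continuous_map_eq [of _ _ "\<lambda>_. y"])
    then show ?thesis using x by (metis restrict_apply')
  qed
  have "quotient_map (sum_topology (\<lambda>(p, f). simplex_space p) ?S) X (\<lambda>((p, f), x). f x)"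
    unfolding quotient_map_def
  proof (intro conjI allI impI)
    show "(\<lambda>((p, f), x). f x) ` topspace (sum_topology (\<lambda>(p, f). simplex_space p) ?S) = topspace X"
    proof
      show "(\<lambda>((p, f), x). f x) ` topspace (sum_topology (\<lambda>(p, f). simplex_space p) ?S)
              \<subseteq> topspace X"
        by (fastforce simp: singular_simplex_def continuous_map_def)
      show "topspace X \<subseteq> (\<lambda>((p, f), x). f x) ` topspace (sum_topology (\<lambda>(p, f). simplex_space p) ?S)"
        using surj by (force simp: image_iff)
    qed
    fix U assume U: "U \<subseteq> topspace X"
    have eq: "{x. (i, x) \<in> {z \<in> topspace (sum_topology (\<lambda>(p, f). simplex_space p) ?S).
                     (\<lambda>((p, f), x). f x) z \<in> U}}
            = {x \<in> topspace (simplex_space (fst i)). snd i x \<in> U}" if "i \<in> ?S" for i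
      using that by (auto split: prod.splits)
    have "openin X U \<longleftrightarrow> (\<forall>p f. singular_simplex p X f \<longrightarrow>
            openin (simplex_space p) {x \<in> topspace (simplex_space p). f x \<in> U})"
      using openin_Delta_kelleyfication [of X U] X U unfolding Delta_generated_def by simp
    also have "\<dots> \<longleftrightarrow> (\<forall>i\<in>?S. openin (simplex_space (fst i))
            {x \<in> topspace (simplex_space (fst i)). snd i x \<in> U})"
      by auto
    finally have X_iff: "openin X U \<longleftrightarrow> (\<forall>i\<in>?S. openin (simplex_space (fst i))
            {x \<in> topspace (simplex_space (fst i)). snd i x \<in> U})" .
    let ?A = "{z \<in> topspace (sum_topology (\<lambda>(p, f). simplex_space p) ?S).
                (\<lambda>((p, f), x). f x) z \<in> U}"
    have "openin (case i of (p, f) \<Rightarrow> simplex_space p) {x. (i, x) \<in> ?A} \<longleftrightarrow>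
          openin (simplex_space (fst i)) {x \<in> topspace (simplex_space (fst i)). snd i x \<in> U}"
      if "i \<in> ?S" for i
      unfolding eq [OF that] by (simp add: case_prod_unfold)
    moreover have "?A \<subseteq> Sigma ?S (topspace \<circ> (\<lambda>(p, f). simplex_space p))" by auto
    ultimately show "openin (sum_topology (\<lambda>(p, f). simplex_space p) ?S) ?A \<longleftrightarrow> openin X U"
      unfolding openin_sum_topology X_iff by blast
  qed
  moreover have "\<forall>(p, f)\<in>?S. singular_simplex p X f" by auto
  ultimately show ?R by (intro exI [of _ ?S] conjI)
next
  assume ?R
  then obtain S where S: "\<forall>(p, f)\<in>S. singular_simplex p X f"
    and q: "quotient_map (sum_topology (\<lambda>(p, f). simplex_space p) S) X (\<lambda>((p, f), x). f x)"
    by (elim exE conjE)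
  have "openin X U" if U: "openin (Delta_kelleyfication X) U" for U
  proof -
    have "openin (sum_topology (\<lambda>(p, f). simplex_space p) S)
            {x \<in> topspace (sum_topology (\<lambda>(p, f). simplex_space p) S).
               (\<lambda>((p, f), x). f x) x \<in> U}"
      unfolding openin_sum_topology
    proof (intro conjI ballI)
      fix i assume i: "i \<in> S"
      obtain p f where pf: "i = (p, f)" by (cases i)
      then have "singular_simplex p X f" using S i by auto
      then have op: "openin (simplex_space p) {x \<in> topspace (simplex_space p). f x \<in> U}"
        using U by (simp add: openin_Delta_kelleyfication)
      have "{x. (i, x) \<in> {z \<in> topspace (sum_topology (\<lambda>(p, f). simplex_space p) S).
                     (\<lambda>((p, f), x). f x) z \<in> U}}
            = {x \<in> topspace (simplex_space p). f x \<in> U}"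
        using i pf by auto
      then show "openin (case i of (p, f) \<Rightarrow> simplex_space p)
          {x. (i, x) \<in> {z \<in> topspace (sum_topology (\<lambda>(p, f). simplex_space p) S).
                     (\<lambda>((p, f), x). f x) z \<in> U}}"
        using op pf by simp
    qed auto
    moreover have "U \<subseteq> topspace X" using openin_subset [OF U] by simp
    ultimately show ?thesis
      using q [unfolded quotient_map_def, THEN conjunct2, rule_format, of U] by blast
  qed
  then show "Delta_generated X"
    unfolding Delta_generated_def topology_eq
    by (intro allI iffI openin_imp_openin_Delta_kelleyfication)
qed


section \<open>Spaces of paths\<close>

text \<open>Maps out of \<open>[0,1]\<close> are represented by their unique extensional representative.\<close>

definition paths_in :: "'a topology \<Rightarrow> (real \<Rightarrow> 'a) set" where
  "paths_in X = {\<gamma> \<in> extensional {0..1}. continuous_map (top_of_set {0..1}) X \<gamma>}"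

definition compact_open_paths :: "'a topology \<Rightarrow> (real \<Rightarrow> 'a) topology" where
  "compact_open_paths X = topology_generated_by
     {{\<gamma> \<in> paths_in X. \<gamma> ` K \<subseteq> U} | K U. compactin (top_of_set {0..1}) K \<and> openin X U}"

text \<open>
  The internal hom \<open>TOP([0,1],X)\<close>. As \<open>[0,1]\<close> is compact Hausdorff, the compact-open topology has
  the exponential property for \<open>[0,1]\<close> among all topological spaces, and \<open>Z \<times> [0,1]\<close> is
  \<open>\<Delta>\<close>-generated whenever \<open>Z\<close> is; so the \<open>\<Delta>\<close>-kelleyfication is the exponential in
  \<open>\<Delta>\<close>-generated spaces.
\<close>

definition TOP_paths :: "'a topology \<Rightarrow> (real \<Rightarrow> 'a) topology" where
  "TOP_paths X = Delta_kelleyfication (compact_open_paths X)"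

definition dpath_space :: "'a topology \<Rightarrow> (real \<Rightarrow> 'a) set \<Rightarrow> (real \<Rightarrow> 'a) topology" where
  "dpath_space X dX = Delta_kelleyfication (subtopology (TOP_paths X) dX)"


section \<open>The monoid \<open>\<M>\<close> and diagrams over \<open>\<M>\<^sup>o\<^sup>p\<close>\<close>

text \<open>
  The product of \<open>\<phi>\<close> and \<open>\<psi>\<close> in \<open>\<M>\<close> is \<open>compose {0..1} \<phi> \<psi>\<close>, and the unit is
  \<open>restrict id {0..1}\<close>.
\<close>

definition reparams :: "(real \<Rightarrow> real) set" ("\<M>") where
  "\<M> = {\<phi> \<in> extensional {0..1}.
          continuous_on {0..1} \<phi> \<and> mono_on {0..1} \<phi> \<and> \<phi> 0 = 0 \<and> \<phi> 1 = 1}"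

text \<open>
  A functor from \<open>\<M>\<^sup>o\<^sup>p\<close> to \<open>\<Delta>\<close>-generated spaces: the value on the unique object, and the action of
  the morphisms.
\<close>

datatype 'z diagram = Diagram (vertex: "'z topology") (act: "(real \<Rightarrow> real) \<Rightarrow> 'z \<Rightarrow> 'z")

definition is_diagram :: "'z diagram \<Rightarrow> bool" where
  "is_diagram D \<longleftrightarrow>
     Delta_generated (vertex D) \<and>
     (\<forall>\<phi>\<in>\<M>. continuous_map (vertex D) (vertex D) (act D \<phi>)) \<and>
     (\<forall>z\<in>topspace (vertex D). act D (restrict id {0..1}) z = z) \<and>
     (\<forall>\<phi>\<in>\<M>. \<forall>\<psi>\<in>\<M>. \<forall>z\<in>topspace (vertex D).
        act D (compose {0..1} \<phi> \<psi>) z = act D \<psi> (act D \<phi> z))"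

definition diagram_map :: "'y diagram \<Rightarrow> 'z diagram \<Rightarrow> ('y \<Rightarrow> 'z) \<Rightarrow> bool" where
  "diagram_map D E f \<longleftrightarrow>
     continuous_map (vertex D) (vertex E) f \<and>
     (\<forall>\<phi>\<in>\<M>. \<forall>z\<in>topspace (vertex D). f (act D \<phi> z) = act E \<phi> (f z))"

definition path_diagram :: "'a topology \<Rightarrow> (real \<Rightarrow> 'a) set \<Rightarrow> (real \<Rightarrow> 'a) diagram" where
  "path_diagram X dX = Diagram (dpath_space X dX) (\<lambda>\<phi> \<gamma>. compose {0..1} \<gamma> \<phi>)"


section \<open>Weak homotopy equivalences and Serre fibrations\<close>

definition cube :: "nat \<Rightarrow> (nat \<Rightarrow> real) topology" where
  "cube n = product_topology (\<lambda>_. top_of_set {0..1}) {..<n}"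

definition cube_boundary :: "nat \<Rightarrow> (nat \<Rightarrow> real) set" where
  "cube_boundary n = {x \<in> topspace (cube n). \<exists>i<n. x i = 0 \<or> x i = 1}"

definition spheroids :: "nat \<Rightarrow> 'a topology \<Rightarrow> 'a \<Rightarrow> ((nat \<Rightarrow> real) \<Rightarrow> 'a) set" where
  "spheroids n X a = {u. continuous_map (cube n) X u \<and> (\<forall>x\<in>cube_boundary n. u x = a)}"

definition spheroid_homotopy ::
  "nat \<Rightarrow> 'a topology \<Rightarrow> 'a \<Rightarrow> (((nat \<Rightarrow> real) \<Rightarrow> 'a) \<times> ((nat \<Rightarrow> real) \<Rightarrow> 'a)) set" where
  "spheroid_homotopy n X a =
     {(u, v). homotopic_with (\<lambda>h. \<forall>x\<in>cube_boundary n. h x = a) (cube n) X u v}"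

definition homotopy_group_set ::
  "nat \<Rightarrow> 'a topology \<Rightarrow> 'a \<Rightarrow> ((nat \<Rightarrow> real) \<Rightarrow> 'a) set set" where
  "homotopy_group_set n X a = spheroids n X a // spheroid_homotopy n X a"

text \<open>
  The maps induced by \<open>f\<close> on path components and on \<open>\<pi>\<^sub>n\<close>; the latter are homomorphisms
  for \<open>n \<ge> 1\<close>, so that they are isomorphisms as soon as they are bijective.
\<close>

definition path_components_map :: "'b topology \<Rightarrow> ('a \<Rightarrow> 'b) \<Rightarrow> 'a set \<Rightarrow> 'b set" where
  "path_components_map Y f C = (\<Union>x\<in>C. path_component_of_set Y (f x))"

definition homotopy_group_map ::
  "nat \<Rightarrow> 'b topology \<Rightarrow> 'b \<Rightarrow> ('a \<Rightarrow> 'b) \<Rightarrow>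
     ((nat \<Rightarrow> real) \<Rightarrow> 'a) set \<Rightarrow> ((nat \<Rightarrow> real) \<Rightarrow> 'b) set" where
  "homotopy_group_map n Y b f c = spheroid_homotopy n Y b `` ((\<lambda>u. f \<circ> u) ` c)"

definition weak_homotopy_equivalence :: "'a topology \<Rightarrow> 'b topology \<Rightarrow> ('a \<Rightarrow> 'b) \<Rightarrow> bool" where
  "weak_homotopy_equivalence X Y f \<longleftrightarrow>
     continuous_map X Y f \<and>
     bij_betw (path_components_map Y f) (path_components_of X) (path_components_of Y) \<and>
     (\<forall>n\<ge>1. \<forall>a\<in>topspace X.
        bij_betw (homotopy_group_map n Y (f a) f)
          (homotopy_group_set n X a) (homotopy_group_set n Y (f a)))"

definition Serre_fibration :: "'a topology \<Rightarrow> 'b topology \<Rightarrow> ('a \<Rightarrow> 'b) \<Rightarrow> bool" where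
  "Serre_fibration E B p \<longleftrightarrow>
     continuous_map E B p \<and>
     (\<forall>n g h. continuous_map (cube n) E g \<and>
        continuous_map (prod_topology (cube n) (top_of_set {0..1::real})) B h \<and>
        (\<forall>x\<in>topspace (cube n). h (x, 0) = p (g x)) \<longrightarrow>
        (\<exists>k. continuous_map (prod_topology (cube n) (top_of_set {0..1::real})) E k \<and>
           (\<forall>x\<in>topspace (cube n). k (x, 0) = g x) \<and>
           (\<forall>z\<in>topspace (prod_topology (cube n) (top_of_set {0..1::real})). p (k z) = h z)))"


section \<open>Homotopy colimits\<close>

text \<open>
  HOL cannot quantify over all spaces inside a definition, so a universe of points is needed.
  The type \<open>'a univ\<close> contains \<open>'a\<close> and is closed under families indexed by the reals, so its
  cardinality \<open>\<kappa>\<close> satisfies \<open>\<kappa> = \<kappa>\<close> to the power continuum. It therefore contains, up to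
  homeomorphism, everything produced from spaces with points in \<open>'a\<close> by the small object argument
  for the projective model structure over \<open>\<M>\<^sup>o\<^sup>p\<close>.
\<close>

datatype 'a univ = Point 'a | Family "real \<Rightarrow> 'a univ"

definition projective_trivial_fibration ::
  "'y diagram \<Rightarrow> 'z diagram \<Rightarrow> ('y \<Rightarrow> 'z) \<Rightarrow> bool" where
  "projective_trivial_fibration E B p \<longleftrightarrow>
     diagram_map E B p \<and>
     weak_homotopy_equivalence (vertex E) (vertex B) p \<and>
     Serre_fibration (vertex E) (vertex B) p"

text \<open>
  The map from the empty diagram to \<open>Z\<close> has the left lifting property with respect to the
  projective trivial fibrations. Testing against diagrams with points in \<open>'z univ\<close> suffices: among
  them is a projective trivial fibration from a cellular diagram onto a copy of \<open>Z\<close>, and lifting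
  the identity of \<open>Z\<close> makes \<open>Z\<close> a retract of a cellular diagram, whence the lifting property with
  respect to all projective trivial fibrations.
\<close>

definition projective_cofibrant :: "'z diagram \<Rightarrow> bool" where
  "projective_cofibrant Z \<longleftrightarrow>
     is_diagram Z \<and>
     (\<forall>(E :: 'z univ diagram) (B :: 'z univ diagram) p g.
        is_diagram E \<and> is_diagram B \<and> projective_trivial_fibration E B p \<and> diagram_map Z B g \<longrightarrow>
        (\<exists>k. diagram_map Z E k \<and> (\<forall>z\<in>topspace (vertex Z). p (k z) = g z)))"

definition cofibrant_replacement :: "'z diagram \<Rightarrow> 'y diagram \<Rightarrow> ('z \<Rightarrow> 'y) \<Rightarrow> bool" where
  "cofibrant_replacement Z D q \<longleftrightarrow>
     projective_cofibrant Z \<and> diagram_map Z D q \<and>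
     weak_homotopy_equivalence (vertex Z) (vertex D) q"

definition orbit_rel :: "'z diagram \<Rightarrow> ('z \<times> 'z) set" where
  "orbit_rel D =
     {(x, y). x \<in> topspace (vertex D) \<and> y \<in> topspace (vertex D) \<and>
        equivclp (\<lambda>z w. z \<in> topspace (vertex D) \<and> (\<exists>\<phi>\<in>\<M>. w = act D \<phi> z)) x y}"

text \<open>
  Since \<open>\<Delta>\<close>-generated spaces are coreflective, their colimits are formed in general topological
  spaces; the colimit over the one-object category \<open>\<M>\<^sup>o\<^sup>p\<close> is the quotient identifying \<open>z\<close> with
  \<open>\<phi>\<close> acting on \<open>z\<close>.
\<close>

definition colim :: "'z diagram \<Rightarrow> 'z set topology" where
  "colim D = topology (\<lambda>U. U \<subseteq> topspace (vertex D) // orbit_rel D \<and> openin (vertex D) (\<Union>U))"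

definition is_hocolim :: "'z set topology \<Rightarrow> 'y diagram \<Rightarrow> bool" where
  "is_hocolim H D \<longleftrightarrow> (\<exists>(Z :: 'z diagram) q. cofibrant_replacement Z D q \<and> H = colim Z)"

lemma equiv_orbit_rel: "equiv (topspace (vertex D)) (orbit_rel D)"
  by (rule equivI)
     (auto simp: orbit_rel_def refl_on_def sym_def trans_def
        intro: equivclp_sym equivclp_trans)

lemma openin_colim:
  "openin (colim D) U \<longleftrightarrow>
     U \<subseteq> topspace (vertex D) // orbit_rel D \<and> openin (vertex D) (\<Union>U)"
proof -
  let ?Q = "topspace (vertex D) // orbit_rel D"
  have "istopology (\<lambda>U. U \<subseteq> ?Q \<and> openin (vertex D) (\<Union>U))"
    unfolding istopology_def
  proof (intro conjI allI impI)
    fix S T assume S: "S \<subseteq> ?Q \<and> openin (vertex D) (\<Union>S)"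
      and T: "T \<subseteq> ?Q \<and> openin (vertex D) (\<Union>T)"
    show "S \<inter> T \<subseteq> ?Q" using S by blast
    have "\<Union>S \<inter> \<Union>T \<subseteq> \<Union>(S \<inter> T)"
    proof
      fix x assume "x \<in> \<Union>S \<inter> \<Union>T"
      then obtain A B where "A \<in> S" "x \<in> A" "B \<in> T" "x \<in> B" by blast
      then have "A = B"
        using S T quotient_disj [OF equiv_orbit_rel, of A D B] by blast
      then show "x \<in> \<Union>(S \<inter> T)" using \<open>A \<in> S\<close> \<open>B \<in> T\<close> \<open>x \<in> A\<close> by blast
    qed
    then have "\<Union>(S \<inter> T) = \<Union>S \<inter> \<Union>T" by blast
    then show "openin (vertex D) (\<Union>(S \<inter> T))" using S T by (metis openin_Int)
  next
    fix \<K> assume K: "\<forall>K\<in>\<K>. K \<subseteq> ?Q \<and> openin (vertex D) (\<Union>K)"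
    show "\<Union>\<K> \<subseteq> ?Q" using K by blast
    have "\<Union>(\<Union>\<K>) = \<Union>((\<lambda>K. \<Union>K) ` \<K>)" by blast
    then show "openin (vertex D) (\<Union>(\<Union>\<K>))" using K by (metis (no_types, lifting) imageE openin_Union)
  qed
  then show ?thesis
    unfolding colim_def by (simp add: topology_inverse')
qed

lemma quotient_map_colim:
  "quotient_map (vertex D) (colim D) (\<lambda>z. orbit_rel D `` {z})"
proof -
  let ?Z = "vertex D" and ?r = "orbit_rel D"
  have Un: "\<Union>(topspace ?Z // ?r) = topspace ?Z"
    by (rule Union_quotient [OF equiv_orbit_rel])
  have top: "topspace (colim D) = topspace ?Z // ?r"
    by (metis Un openin_colim openin_subset openin_topspace subset_antisym subset_refl)
  have pre: "{z \<in> topspace ?Z. ?r `` {z} \<in> U} = \<Union>U" if U: "U \<subseteq> topspace ?Z // ?r" for U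
  proof (intro equalityI subsetI)
    fix z assume "z \<in> {z \<in> topspace ?Z. ?r `` {z} \<in> U}"
    then have "z \<in> topspace ?Z" "?r `` {z} \<in> U" by simp_all
    moreover have "z \<in> ?r `` {z}"
      by (rule equiv_class_self [OF equiv_orbit_rel]) fact
    ultimately show "z \<in> \<Union>U" by (intro UnionI)
  next
    fix z assume "z \<in> \<Union>U"
    then obtain A where A: "A \<in> U" "z \<in> A" by blast
    then have AQ: "A \<in> topspace ?Z // ?r" using U by blast
    have z: "z \<in> topspace ?Z" using A U Un by blast
    have "A = ?r `` {z}"
    proof -
      obtain w where w: "A = ?r `` {w}" using AQ by (rule quotientE)
      then have "(w, z) \<in> ?r" using A(2) by simp
      then show ?thesis using w equiv_class_eq [OF equiv_orbit_rel] by metis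
    qed
    then show "z \<in> {z \<in> topspace ?Z. ?r `` {z} \<in> U}" using A z by blast
  qed
  show ?thesis
    unfolding quotient_map_def
  proof (intro conjI allI impI)
    show "(\<lambda>z. ?r `` {z}) ` topspace ?Z = topspace (colim D)"
      unfolding top quotient_def by blast
  next
    fix U assume "U \<subseteq> topspace (colim D)"
    then show "openin ?Z {z \<in> topspace ?Z. ?r `` {z} \<in> U} \<longleftrightarrow> openin (colim D) U"
      by (simp add: top pre openin_colim)
  qed
qed

text \<open>
  Having the same weak homotopy type: being related by a finite zigzag of weak homotopy
  equivalences between \<open>\<Delta>\<close>-generated spaces, here with points in a universe containing copies of
  both spaces.
\<close>

definition same_weak_homotopy_type :: "'a topology \<Rightarrow> 'b topology \<Rightarrow> bool" where
  "same_weak_homotopy_type X Y \<longleftrightarrow>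
     (\<exists>(P :: ('a + 'b) univ topology) (Q :: ('a + 'b) univ topology).
        X homeomorphic_space P \<and> Y homeomorphic_space Q \<and>
        equivclp (\<lambda>A B. Delta_generated A \<and> Delta_generated B \<and>
                        (\<exists>f. weak_homotopy_equivalence A B f)) P Q)"

end

theory Submission
  imports Defs "HOL-Analysis.Abstract_Topological_Spaces"
begin

text \<open>
  Let \<open>Z\<close> be a cofibrant replacement of the diagram; its underlying space is weakly equivalent to
  \<open>dX\<close>, so it suffices that the quotient map \<open>\<pi>\<close> from \<open>Z\<close> to its colimit is a weak homotopy
  equivalence. Every \<open>\<phi>\<close> acts on \<open>dX\<close> by a map homotopic to the identity (interpolate linearly
  between \<open>\<phi>\<close> and the identity), hence acts on \<open>Z\<close> by a weak homotopy equivalence.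

  Let \<open>F\<close> be the endomorphism of \<open>\<M>\<close> performing \<open>\<phi>\<close> on the left half of the interval and
  nothing on the right half, \<open>a t = min 1 (2 t)\<close> and \<open>b t = max 0 (2 t - 1)\<close>. Then
  \<open>a \<circ> F \<phi> = \<phi> \<circ> a\<close> and \<open>b \<circ> F \<phi> = b\<close>, which is why the classifying space of \<open>\<M>\<close> is
  contractible. For \<open>Z\<close> it means that \<open>a\<close> acts as a diagram map from \<open>Z\<close> to the restriction
  \<open>F\<^sup>*Z\<close> along \<open>F\<close>, and \<open>b\<close> as one from the constant diagram on \<open>Z\<close> to \<open>F\<^sup>*Z\<close>. Turning the latter into
  a projective trivial fibration by a mapping path space and lifting \<open>a\<close> against it yields an
  orbit-invariant map \<open>k\<close> from \<open>Z\<close> to itself, together with equivariant paths from \<open>b (k z)\<close> to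
  \<open>a z\<close>. If \<open>r\<close> is the factorization of \<open>k\<close> through \<open>\<pi>\<close>, then \<open>b \<circ> r \<circ> \<pi>\<close> is homotopic to
  \<open>a\<close>, and the images of the paths in the colimit show that \<open>\<pi> \<circ> r\<close> is homotopic to the identity.
  Thus \<open>r \<circ> \<pi>\<close> and \<open>\<pi> \<circ> r\<close> are weak homotopy equivalences, and so is \<open>\<pi>\<close>.
\<close>

abbreviation I01 :: "real topology" where
  "I01 \<equiv> top_of_set {0..1}"

section \<open>Maps out of \<open>\<Delta>\<close>-generated spaces\<close>

lemma continuous_map_id_Delta_kelleyfication:
  "continuous_map (Delta_kelleyfication X) X (\<lambda>x. x)"
proof -
  have "{x \<in> topspace X. x \<in> U} = U" if "openin X U" for U
    using openin_subset [OF that] by blast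
  then show ?thesis
    unfolding continuous_map by (auto intro: openin_imp_openin_Delta_kelleyfication)
qed

lemma continuous_map_from_Delta_kelleyfication:
  assumes "continuous_map X Y f"
  shows "continuous_map (Delta_kelleyfication X) Y f"
  using continuous_map_compose [OF continuous_map_id_Delta_kelleyfication assms]
  by (simp add: o_def)

text \<open>This is the coreflection property. Openness of a preimage in \<open>T\<close> is tested
  on singular simplices of \<open>T\<close>, and composing them with \<open>f\<close> gives singular
  simplices of \<open>X\<close>, which define the topology of the target.\<close>

lemma continuous_map_into_Delta_kelleyfication:
  assumes T: "Delta_generated T"
  shows "continuous_map T (Delta_kelleyfication X) f \<longleftrightarrow> continuous_map T X f"
proof
  assume "continuous_map T (Delta_kelleyfication X) f"
  from continuous_map_compose [OF this continuous_map_id_Delta_kelleyfication]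
  show "continuous_map T X f" by (simp add: o_def)
next
  assume f: "continuous_map T X f"
  show "continuous_map T (Delta_kelleyfication X) f"
    unfolding continuous_map_def
  proof (intro conjI allI impI)
    show "f \<in> topspace T \<rightarrow> topspace (Delta_kelleyfication X)"
      using f by (simp add: continuous_map_def)
    fix U assume U: "openin (Delta_kelleyfication X) U"
    have "openin (Delta_kelleyfication T) {x \<in> topspace T. f x \<in> U}"
      unfolding openin_Delta_kelleyfication
    proof (intro conjI allI impI)
      fix p s assume s: "singular_simplex p T s"
      \<comment> \<open>Singular simplices are required to be extensional, which
        \<open>f \<circ> s\<close> itself need not be.\<close>
      define g where "g = restrict (f \<circ> s) (standard_simplex p)"
      have "continuous_map (simplex_space p) X (f \<circ> s)"
        using s f continuous_map_compose by (auto simp: singular_simplex_def)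
      then have "singular_simplex p X g"
        unfolding singular_simplex_def g_def
        by (auto intro: continuous_map_eq)
      then have "openin (simplex_space p) {x \<in> topspace (simplex_space p). g x \<in> U}"
        using U by (simp add: openin_Delta_kelleyfication)
      moreover have "s \<in> topspace (simplex_space p) \<rightarrow> topspace T"
        using s unfolding singular_simplex_def continuous_map_def by blast
      then have "{x \<in> topspace (simplex_space p). s x \<in> {x \<in> topspace T. f x \<in> U}}
          = {x \<in> topspace (simplex_space p). g x \<in> U}"
        by (auto simp: g_def)
      ultimately show "openin (simplex_space p)
          {x \<in> topspace (simplex_space p). s x \<in> {x \<in> topspace T. f x \<in> U}}" by simp
    qed auto
    then show "openin T {x \<in> topspace T. f x \<in> U}"
      using T by (simp add: Delta_generated_def)
  qed
qed

text \<open>The quotient map is also continuous into the kelleyfication of \<open>W\<close>, so the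
  identity of \<open>W\<close> factors continuously into that kelleyfication, which therefore has no
  additional open sets.\<close>

lemma Delta_generated_quotient:
  assumes q: "quotient_map T W q" and T: "Delta_generated T"
  shows "Delta_generated W"
proof -
  have "continuous_map T (Delta_kelleyfication W) q"
    using T q by (simp add: continuous_map_into_Delta_kelleyfication quotient_imp_continuous_map)
  then have "continuous_map W (Delta_kelleyfication W) (\<lambda>x. x)"
    using continuous_compose_quotient_map [OF q, of _ "\<lambda>x. x"] by (simp add: o_def)
  then have id: "continuous_map W (Delta_kelleyfication W) (\<lambda>x. x)" .
  have "openin W U" if U: "openin (Delta_kelleyfication W) U" for U
  proof -
    have "{x \<in> topspace W. x \<in> U} = U"
      using openin_subset [OF U] by auto
    then show ?thesis using openin_continuous_map_preimage [OF id U] by simp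
  qed
  then show ?thesis
    unfolding Delta_generated_def topology_eq
    by (auto intro: openin_imp_openin_Delta_kelleyfication)
qed

lemma Delta_generated_retract:
  assumes "retraction_maps T W r s" "Delta_generated T"
  shows "Delta_generated W"
  using assms Delta_generated_quotient retraction_imp_quotient_map
  unfolding retraction_map_def by blast

lemma Delta_generated_homeomorphic:
  assumes "homeomorphic_maps T W r s" "Delta_generated T"
  shows "Delta_generated W"
  using assms Delta_generated_retract homeomorphic_imp_retraction_maps by blast

section \<open>Simplices, cubes and cylinders over cubes as test spaces\<close>

lemma Delta_generated_simplex: "Delta_generated (simplex_space p)"
proof -
  have "openin (simplex_space p) U" if U: "openin (Delta_kelleyfication (simplex_space p)) U" for U
  proof -
    \<comment> \<open>The identity is itself one of the test simplices, so the test set on it is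
      \<open>U\<close>.\<close>
    define i where "i = restrict (\<lambda>x. x) (standard_simplex p)"
    have "continuous_map (simplex_space p) (simplex_space p) i"
      by (rule continuous_map_eq [OF continuous_map_id]) (auto simp: i_def)
    then have "singular_simplex p (simplex_space p) i"
      by (simp add: singular_simplex_def i_def)
    then have "openin (simplex_space p) {x \<in> topspace (simplex_space p). i x \<in> U}"
      using U unfolding openin_Delta_kelleyfication by blast
    moreover have "{x \<in> topspace (simplex_space p). i x \<in> U} = U"
      using openin_subset [OF U] by (auto simp: i_def)
    ultimately show ?thesis by simp
  qed
  then show ?thesis
    unfolding Delta_generated_def topology_eq
    by (auto intro: openin_imp_openin_Delta_kelleyfication)
qed

lemma topspace_cube: "topspace (cube n) = PiE {..<n} (\<lambda>_. {0..1})"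
  by (simp add: cube_def)

lemma continuous_map_into_cube:
  "continuous_map X (cube n) f \<longleftrightarrow>
     (\<forall>x\<in>topspace X. f x \<in> PiE {..<n} (\<lambda>_. {0..1})) \<and>
     (\<forall>i<n. continuous_map X euclideanreal (\<lambda>x. f x i))"
  unfolding cube_def continuous_map_componentwise
  by (auto simp: continuous_map_in_subtopology Pi_iff image_subset_iff PiE_iff)

lemma continuous_map_cube_coord:
  "i < n \<Longrightarrow> continuous_map (cube n) euclideanreal (\<lambda>x. x i)"
  using continuous_map_into_cube [of "cube n" n "\<lambda>x. x"] by simp

text \<open>The cube is a retract of the simplex of the same dimension. Dividing the coordinates by
  \<open>n\<close> makes their sum at most 1, and coordinate \<open>n\<close> takes up the remaining
  mass; the retraction multiplies by \<open>n\<close> and clips at 1.\<close>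

lemma Delta_generated_cube: "Delta_generated (cube n)"
proof -
  define r :: "(nat \<Rightarrow> real) \<Rightarrow> nat \<Rightarrow> real" where
    "r = (\<lambda>y. restrict (\<lambda>i. min 1 (real n * y i)) {..<n})"
  define s :: "(nat \<Rightarrow> real) \<Rightarrow> nat \<Rightarrow> real" where
    "s = (\<lambda>x i. if i < n then x i / real n else if i = n then 1 - (\<Sum>j<n. x j / real n) else 0)"
  have "continuous_map (simplex_space n) (cube n) r"
    unfolding continuous_map_into_cube
  proof (intro conjI ballI allI impI)
    fix i assume "i < n"
    have "continuous_map (simplex_space n) euclideanreal (\<lambda>y. min 1 (real n * y i))"
      by (intro continuous_intros continuous_map_from_subtopology) auto
    then show "continuous_map (simplex_space n) euclideanreal (\<lambda>y. r y i)"
      using \<open>i < n\<close> by (simp add: r_def)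
  qed (auto simp: r_def standard_simplex_def)
  moreover have "continuous_map (cube n) (simplex_space n) s"
    unfolding continuous_map_in_subtopology continuous_map_componentwise_UNIV
  proof (intro conjI allI)
    fix k
    have "continuous_map (cube n) euclideanreal (\<lambda>x. 1 - (\<Sum>j<n. x j / real n))"
      by (intro continuous_intros continuous_map_real_divide continuous_map_cube_coord) auto
    moreover have "continuous_map (cube n) euclideanreal (\<lambda>x. x k / real n)" if "k < n"
      using that by (intro continuous_intros continuous_map_real_divide continuous_map_cube_coord) auto
    ultimately show "continuous_map (cube n) euclideanreal (\<lambda>x. s x k)"
      by (cases "k < n"; cases "k = n") (auto simp: s_def)
  next
    have "s x \<in> standard_simplex n" if x: "x \<in> topspace (cube n)" for x
    proof -
      have x01: "0 \<le> x i" "x i \<le> 1" if "i < n" for i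
        using x that by (auto simp: topspace_cube PiE_iff)
      have le: "x i / real n \<le> 1 / real n" if "i < n" for i
        using x01 [OF that] by (simp add: divide_right_mono)
      have "(\<Sum>j<n. x j / real n) \<le> (\<Sum>j<n. 1 / real n)"
        using le by (intro sum_mono) auto
      also have "\<dots> \<le> 1" by simp
      finally have S1: "(\<Sum>j<n. x j / real n) \<le> 1" .
      have S0: "0 \<le> (\<Sum>j<n. x j / real n)"
        using x01 by (intro sum_nonneg) auto
      have "x i / real n \<le> 1" if "i < n" for i
      proof -
        have "1 / real n \<le> 1" using that by simp
        then show ?thesis using le [OF that] by linarith
      qed
      moreover have "(\<Sum>i\<le>n. s x i) = 1"
      proof -
        have "(\<Sum>i\<le>n. s x i) = (\<Sum>i<n. s x i) + s x n"
          by (simp flip: lessThan_Suc_atMost)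
        also have "\<dots> = 1" by (simp add: s_def)
        finally show ?thesis .
      qed
      ultimately show ?thesis
        using S0 S1 x01 by (auto simp: standard_simplex_def s_def)
    qed
    then show "s \<in> topspace (cube n) \<rightarrow> standard_simplex n" by blast
  qed
  moreover have "r (s x) = x" if "x \<in> topspace (cube n)" for x
  proof
    fix i show "r (s x) i = x i"
      using that by (auto simp: topspace_cube PiE_iff r_def s_def extensional_def)
  qed
  ultimately have "retraction_maps (simplex_space n) (cube n) r s"
    by (simp add: retraction_maps_def)
  then show ?thesis
    using Delta_generated_retract Delta_generated_simplex by blast
qed

text \<open>The last coordinate of the cube of dimension \<open>Suc n\<close> serves as the interval
  factor. This makes maps from cylinders into kelleyfied spaces accessible, which lifts and
  homotopies require.\<close>

lemma Delta_generated_cube_cylinder: "Delta_generated (prod_topology (cube n) I01)"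
proof -
  define r :: "(nat \<Rightarrow> real) \<Rightarrow> (nat \<Rightarrow> real) \<times> real" where
    "r = (\<lambda>x. (restrict x {..<n}, x n))"
  define s :: "(nat \<Rightarrow> real) \<times> real \<Rightarrow> nat \<Rightarrow> real" where
    "s = (\<lambda>(x, t). restrict (\<lambda>i. if i < n then x i else t) {..<Suc n})"
  have "continuous_map (cube (Suc n)) (prod_topology (cube n) I01) r"
    unfolding r_def continuous_map_paired
  proof
    show "continuous_map (cube (Suc n)) (cube n) (\<lambda>x. restrict x {..<n})"
      unfolding continuous_map_into_cube
      using continuous_map_cube_coord [of _ "Suc n"] by (auto simp: topspace_cube PiE_iff)
    show "continuous_map (cube (Suc n)) I01 (\<lambda>x. x n)"
      using continuous_map_cube_coord [of n "Suc n"]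
      by (auto simp: continuous_map_in_subtopology topspace_cube PiE_iff)
  qed
  moreover have "continuous_map (prod_topology (cube n) I01) (cube (Suc n)) s"
    unfolding continuous_map_into_cube
  proof (intro conjI ballI allI impI)
    fix i assume i: "i < Suc n"
    have "continuous_map (prod_topology (cube n) I01) euclideanreal (\<lambda>z. fst z i)" if "i < n"
      using continuous_map_compose [OF continuous_map_fst continuous_map_cube_coord [OF that]]
      by (simp add: o_def)
    moreover have "continuous_map (prod_topology (cube n) I01) euclideanreal snd"
      using continuous_map_snd [of "cube n" I01] by (simp add: continuous_map_in_subtopology)
    ultimately show "continuous_map (prod_topology (cube n) I01) euclideanreal (\<lambda>z. s z i)"
      using i by (cases "i < n") (auto simp: s_def case_prod_unfold)
  next
    fix z assume "z \<in> topspace (prod_topology (cube n) I01)"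
    then show "s z \<in> PiE {..<Suc n} (\<lambda>_. {0..1})"
      by (cases z) (simp add: s_def topspace_cube PiE_iff)
  qed
  moreover have "r (s z) = z" if z: "z \<in> topspace (prod_topology (cube n) I01)" for z
  proof -
    obtain x t where "z = (x, t)" by (cases z)
    moreover have "x \<in> extensional {..<n}"
      using z \<open>z = (x, t)\<close> by (simp add: topspace_cube PiE_iff)
    then have "restrict (s (x, t)) {..<n} = x"
      by (intro ext) (simp add: s_def extensional_def restrict_def)
    ultimately show ?thesis by (simp add: r_def s_def)
  qed
  ultimately have "retraction_maps (cube (Suc n)) (prod_topology (cube n) I01) r s"
    by (simp add: retraction_maps_def)
  then show ?thesis
    using Delta_generated_retract Delta_generated_cube by blast
qed

lemma Delta_generated_cube_homotopy: "Delta_generated (prod_topology I01 (cube n))"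
  using Delta_generated_homeomorphic [OF _ Delta_generated_cube_cylinder]
    homeomorphic_maps_swap by blast

section \<open>The compact-open topology on paths\<close>

lemma topspace_compact_open_paths [simp]: "topspace (compact_open_paths X) = paths_in X"
proof
  show "topspace (compact_open_paths X) \<subseteq> paths_in X"
    by (auto simp: compact_open_paths_def)
  \<comment> \<open>With \<open>K\<close> and \<open>U\<close> both empty the subbasic set consists
    of all paths.\<close>
  have "{\<gamma> \<in> paths_in X. \<gamma> ` {} \<subseteq> {}} \<subseteq> topspace (compact_open_paths X)"
    unfolding compact_open_paths_def topology_generated_by_topspace
    by (rule Union_upper) (use openin_empty compactin_empty in blast)
  then show "paths_in X \<subseteq> topspace (compact_open_paths X)" by simp
qed

lemma paths_inD:
  assumes "\<gamma> \<in> paths_in X"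
  shows "continuous_map I01 X \<gamma>" "\<gamma> \<in> extensional {0..1}" "t \<in> {0..1} \<Longrightarrow> \<gamma> t \<in> topspace X"
  using assms by (auto simp: paths_in_def continuous_map_def)

lemma restrict_in_paths_in: "continuous_map I01 X g \<Longrightarrow> restrict g {0..1} \<in> paths_in X"
  by (auto simp: paths_in_def intro: continuous_map_eq)

lemma openin_compact_open_subbasis:
  "compactin I01 K \<Longrightarrow> openin X U \<Longrightarrow>
    openin (compact_open_paths X) {\<gamma> \<in> paths_in X. \<gamma> ` K \<subseteq> U}"
  unfolding compact_open_paths_def by (rule topology_generated_by_Basis) blast

lemma continuous_map_into_compact_open:
  assumes "\<And>x. x \<in> topspace T \<Longrightarrow> f x \<in> paths_in X"
    and "\<And>K U. compactin I01 K \<Longrightarrow> openin X U \<Longrightarrow> openin T {x \<in> topspace T. f x ` K \<subseteq> U}"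
  shows "continuous_map T (compact_open_paths X) f"
  unfolding compact_open_paths_def continuous_on_generated_topo_iff
proof (intro conjI allI impI)
  fix V assume "V \<in> {{\<gamma> \<in> paths_in X. \<gamma> ` K \<subseteq> U} |K U. compactin I01 K \<and> openin X U}"
  then obtain K U where KU: "compactin I01 K" "openin X U" and V: "V = {\<gamma> \<in> paths_in X. \<gamma> ` K \<subseteq> U}"
    by blast
  have "f -` V \<inter> topspace T = {x \<in> topspace T. f x ` K \<subseteq> U}"
    using assms(1) V by auto
  then show "openin T (f -` V \<inter> topspace T)"
    using assms(2) [OF KU] by simp
next
  have "f ` topspace T \<subseteq> topspace (compact_open_paths X)"
    using assms(1) by auto
  then show "f ` topspace T \<subseteq> \<Union> {{\<gamma> \<in> paths_in X. \<gamma> ` K \<subseteq> U} |K U. compactin I01 K \<and> openin X U}"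
    unfolding compact_open_paths_def topology_generated_by_topspace .
qed

text \<open>One half of the exponential law. By the tube lemma, if \<open>{x} \<times> K\<close>
  lies in an open set, so does \<open>A \<times> K\<close> for some neighbourhood \<open>A\<close>
  of \<open>x\<close>.\<close>

lemma continuous_map_curry:
  assumes f: "continuous_map (prod_topology T I01) X f"
  shows "continuous_map T (compact_open_paths X) (\<lambda>x. restrict (\<lambda>t. f (x, t)) {0..1})"
proof (rule continuous_map_into_compact_open)
  fix x assume x: "x \<in> topspace T"
  have "continuous_map I01 X (f \<circ> (\<lambda>t. (x, t)))"
    by (rule continuous_map_compose [OF _ f]) (simp add: continuous_map_paired x)
  then show "restrict (\<lambda>t. f (x, t)) {0..1} \<in> paths_in X"
    by (intro restrict_in_paths_in) (simp add: o_def)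
next
  fix K U assume K: "compactin I01 K" and U: "openin X U"
  have K01: "K \<subseteq> {0..1}" using compactin_subset_topspace [OF K] by simp
  let ?W = "{z \<in> topspace (prod_topology T I01). f z \<in> U}"
  have W: "openin (prod_topology T I01) ?W"
    using f U openin_continuous_map_preimage by blast
  have eq: "{x \<in> topspace T. restrict (\<lambda>t. f (x, t)) {0..1} ` K \<subseteq> U}
      = {x \<in> topspace T. {x} \<times> K \<subseteq> ?W}"
    using K01 by (auto simp: image_subset_iff)
  show "openin T {x \<in> topspace T. restrict (\<lambda>t. f (x, t)) {0..1} ` K \<subseteq> U}"
    unfolding eq
  proof (subst openin_subopen, clarify)
    fix x assume x: "x \<in> topspace T" and sub: "{x} \<times> K \<subseteq> ?W"
    obtain A B where AB: "openin T A" "openin I01 B" "x \<in> A" "K \<subseteq> B" "A \<times> B \<subseteq> ?W"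
      using tube_lemma_right [OF W K x sub] by blast
    have "A \<subseteq> topspace T" using AB(1) openin_subset by blast
    then have "A \<subseteq> {x \<in> topspace T. {x} \<times> K \<subseteq> ?W}"
      using AB(4,5) by blast
    then show "\<exists>S. openin T S \<and> x \<in> S \<and> S \<subseteq> {x \<in> topspace T. {x} \<times> K \<subseteq> ?W}"
      using AB by blast
  qed
qed

text \<open>The other half of the exponential law, resting on local compactness of the interval:
  continuity of a single path gives a compact neighbourhood \<open>K\<close> of \<open>t\<close>
  sent into \<open>U\<close>, and the condition on \<open>K\<close> is open in the path.\<close>

lemma continuous_map_path_eval:
  "continuous_map (prod_topology (compact_open_paths X) I01) X (\<lambda>(\<gamma>, t). \<gamma> t)"
  unfolding continuous_map_def
proof (intro conjI allI impI)
  show "(\<lambda>(\<gamma>, t). \<gamma> t) \<in> topspace (prod_topology (compact_open_paths X) I01) \<rightarrow> topspace X"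
    using paths_inD(3) by fastforce
  fix U assume U: "openin X U"
  show "openin (prod_topology (compact_open_paths X) I01)
     {z \<in> topspace (prod_topology (compact_open_paths X) I01). (case z of (\<gamma>, t) \<Rightarrow> \<gamma> t) \<in> U}"
    (is "openin ?P ?S")
  proof (subst openin_subopen, clarify)
    fix \<gamma> t assume z: "(\<gamma>, t) \<in> topspace ?P" and in_U: "\<gamma> t \<in> U"
    then have \<gamma>: "\<gamma> \<in> paths_in X" and t: "t \<in> {0..1}" by auto
    have "openin I01 {s \<in> {0..1}. \<gamma> s \<in> U}"
      using openin_continuous_map_preimage [OF paths_inD(1) [OF \<gamma>] U] by simp
    then obtain A where A: "open A" "{s \<in> {0..1}. \<gamma> s \<in> U} = {0..1} \<inter> A"
      unfolding openin_open by auto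
    have "t \<in> A" using A(2) t in_U by blast
    then obtain e where e: "e > 0" "cball t e \<subseteq> A"
      using A(1) open_contains_cball by blast
    define K where "K = {0..1} \<inter> cball t e"
    have K: "compactin I01 K"
      unfolding K_def by (auto simp: compactin_subtopology intro: compact_Int)
    have "\<gamma> ` K \<subseteq> U" using A(2) e(2) by (auto simp: K_def)
    let ?O = "{\<gamma> \<in> paths_in X. \<gamma> ` K \<subseteq> U} \<times> ({0..1} \<inter> ball t e)"
    have "openin ?P ?O"
      unfolding openin_prod_Times_iff
      using openin_compact_open_subbasis [OF K U] by (simp add: openin_open_Int)
    moreover have "(\<gamma>, t) \<in> ?O" using \<gamma> t e(1) \<open>\<gamma> ` K \<subseteq> U\<close> by auto
    moreover have "?O \<subseteq> ?S"
    proof clarify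
      fix \<delta> s assume \<delta>: "\<delta> \<in> paths_in X" "\<delta> ` K \<subseteq> U" and s: "s \<in> {0..1}" "s \<in> ball t e"
      have "s \<in> K" using s by (auto simp: K_def)
      then show "(\<delta>, s) \<in> topspace ?P \<and> \<delta> s \<in> U" using \<delta> s by auto
    qed
    ultimately show "\<exists>T. openin ?P T \<and> (\<gamma>, t) \<in> T \<and> T \<subseteq> ?S" by blast
  qed
qed

lemma continuous_map_eval:
  assumes "continuous_map T (compact_open_paths X) f" "continuous_map T I01 g"
  shows "continuous_map T X (\<lambda>x. f x (g x))"
proof -
  have "continuous_map T (prod_topology (compact_open_paths X) I01) (\<lambda>x. (f x, g x))"
    using assms by (simp add: continuous_map_paired)
  from continuous_map_compose [OF this continuous_map_path_eval] show ?thesis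
    by (simp add: o_def)
qed

lemma continuous_map_postcompose:
  assumes "continuous_map T (compact_open_paths X) f" "continuous_map X Y h"
  shows "continuous_map T (compact_open_paths Y) (\<lambda>x. restrict (h \<circ> f x) {0..1})"
proof -
  have "continuous_map (prod_topology T I01) (compact_open_paths X) (f \<circ> fst)"
    by (intro continuous_map_compose [OF continuous_map_fst assms(1)])
  from continuous_map_eval [OF this continuous_map_snd]
  have "continuous_map (prod_topology T I01) X (\<lambda>z. (f \<circ> fst) z (snd z))" .
  from continuous_map_compose [OF this assms(2)]
  have "continuous_map (prod_topology T I01) Y (\<lambda>z. h (f (fst z) (snd z)))"
    by (simp add: o_def)
  from continuous_map_curry [OF this] show ?thesis by (simp add: o_def)
qed

section \<open>Weak homotopy equivalences\<close>

text \<open>Serves both path components and homotopy classes of spheroids, so that all later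
  arguments can be carried out on representatives.\<close>

lemma bij_betw_quotients_iff:
  assumes A: "equiv A r" and B: "equiv B s"
    and F: "\<And>u v. (u, v) \<in> r \<Longrightarrow> (F u, F v) \<in> s"
  shows "bij_betw (\<lambda>c. s `` (F ` c)) (A // r) (B // s) \<longleftrightarrow>
    (\<forall>u\<in>A. \<forall>v\<in>A. (F u, F v) \<in> s \<longrightarrow> (u, v) \<in> r) \<and> (\<forall>v\<in>B. \<exists>u\<in>A. (F u, v) \<in> s)"
proof -
  let ?G = "\<lambda>c. s `` (F ` c)"
  have FB: "F u \<in> B" if "u \<in> A" for u
    using F [of u u] that A B by (auto simp: equiv_def refl_on_def)
  have G: "?G (r `` {u}) = s `` {F u}" if u: "u \<in> A" for u
  proof
    show "?G (r `` {u}) \<subseteq> s `` {F u}"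
    proof clarify
      fix w v assume "(u, v) \<in> r" "(F v, w) \<in> s"
      then show "(F u, w) \<in> s" using F B by (meson equivE transD)
    qed
    show "s `` {F u} \<subseteq> ?G (r `` {u})"
      using equiv_class_self [OF A u] by blast
  qed
  have eq_r: "r `` {u} = r `` {v} \<longleftrightarrow> (u, v) \<in> r" if "u \<in> A" "v \<in> A" for u v
    using eq_equiv_class_iff [OF A that] .
  have eq_s: "s `` {F u} = s `` {w} \<longleftrightarrow> (F u, w) \<in> s" if "u \<in> A" "w \<in> B" for u w
    using eq_equiv_class_iff [OF B FB that(2)] that(1) by blast
  have "inj_on ?G (A // r) \<longleftrightarrow> (\<forall>u\<in>A. \<forall>v\<in>A. (F u, F v) \<in> s \<longrightarrow> (u, v) \<in> r)"
  proof
    assume inj: "inj_on ?G (A // r)"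
    show "\<forall>u\<in>A. \<forall>v\<in>A. (F u, F v) \<in> s \<longrightarrow> (u, v) \<in> r"
    proof (intro ballI impI)
      fix u v assume uv: "u \<in> A" "v \<in> A" "(F u, F v) \<in> s"
      then have "?G (r `` {u}) = ?G (r `` {v})"
        by (simp only: G eq_s FB)
      then have "r `` {u} = r `` {v}"
        by (rule inj_onD [OF inj]) (use uv in \<open>auto intro: quotientI\<close>)
      then show "(u, v) \<in> r" using eq_r uv by blast
    qed
  next
    assume R: "\<forall>u\<in>A. \<forall>v\<in>A. (F u, F v) \<in> s \<longrightarrow> (u, v) \<in> r"
    show "inj_on ?G (A // r)"
    proof (rule inj_onI)
      fix c d assume "c \<in> A // r" "d \<in> A // r" and eq: "?G c = ?G d"
      then obtain u v where uv: "u \<in> A" "v \<in> A" and c: "c = r `` {u}" and d: "d = r `` {v}"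
        by (metis quotientE)
      have "(F u, F v) \<in> s"
        using eq uv unfolding c d by (simp only: G eq_s FB)
      then show "c = d" using R uv eq_r c d by blast
    qed
  qed
  moreover have "?G ` (A // r) = B // s \<longleftrightarrow> (\<forall>v\<in>B. \<exists>u\<in>A. (F u, v) \<in> s)"
  proof -
    have img: "?G ` (A // r) = (\<lambda>u. s `` {F u}) ` A"
    proof -
      have "A // r = (\<lambda>u. r `` {u}) ` A" by (auto simp: quotient_def)
      then show ?thesis using G by (simp add: image_image)
    qed
    show ?thesis
    proof
      assume L: "?G ` (A // r) = B // s"
      show "\<forall>v\<in>B. \<exists>u\<in>A. (F u, v) \<in> s"
      proof
        fix v assume v: "v \<in> B"
        then have "s `` {v} \<in> (\<lambda>u. s `` {F u}) ` A"
          using L img quotientI by metis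
        then obtain u where "u \<in> A" "s `` {v} = s `` {F u}" by blast
        then show "\<exists>u\<in>A. (F u, v) \<in> s" using eq_s v by metis
      qed
    next
      assume R: "\<forall>v\<in>B. \<exists>u\<in>A. (F u, v) \<in> s"
      show "?G ` (A // r) = B // s"
        unfolding img
      proof
        show "(\<lambda>u. s `` {F u}) ` A \<subseteq> B // s" using FB quotientI by fastforce
        show "B // s \<subseteq> (\<lambda>u. s `` {F u}) ` A"
        proof
          fix d assume "d \<in> B // s"
          then obtain v where v: "v \<in> B" "d = s `` {v}" by (metis quotientE)
          then obtain u where "u \<in> A" "(F u, v) \<in> s" using R by blast
          then show "d \<in> (\<lambda>u. s `` {F u}) ` A" using eq_s v by blast
        qed
      qed
    qed
  qed
  ultimately show ?thesis by (simp add: bij_betw_def)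
qed

section \<open>Spheroids and path components on the level of representatives\<close>

lemma cube_boundary_subset: "x \<in> cube_boundary n \<Longrightarrow> x \<in> topspace (cube n)"
  by (simp add: cube_boundary_def)

lemma spheroid_homotopy_iff:
  "(u, v) \<in> spheroid_homotopy n X a \<longleftrightarrow>
    (\<exists>h. continuous_map (prod_topology I01 (cube n)) X h \<and>
      (\<forall>x\<in>topspace (cube n). h (0, x) = u x) \<and> (\<forall>x\<in>topspace (cube n). h (1, x) = v x) \<and>
      (\<forall>t\<in>{0..1}. \<forall>x\<in>cube_boundary n. h (t, x) = a))"
  unfolding spheroid_homotopy_def mem_Collect_eq prod.case
  by (rule homotopic_with) (simp add: cube_boundary_def)

lemma spheroid_homotopy_imp_spheroids:
  assumes "(u, v) \<in> spheroid_homotopy n X a"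
  shows "u \<in> spheroids n X a" "v \<in> spheroids n X a"
proof -
  have h: "homotopic_with (\<lambda>h. \<forall>x\<in>cube_boundary n. h x = a) (cube n) X u v"
    using assms by (simp add: spheroid_homotopy_def)
  show "u \<in> spheroids n X a" "v \<in> spheroids n X a"
    using homotopic_with_imp_continuous_maps [OF h] homotopic_with_imp_property [OF h]
    by (simp_all add: spheroids_def)
qed

lemma equiv_spheroid_homotopy: "equiv (spheroids n X a) (spheroid_homotopy n X a)"
proof (rule equivI)
  show "spheroid_homotopy n X a \<subseteq> spheroids n X a \<times> spheroids n X a"
    by (auto dest: spheroid_homotopy_imp_spheroids)
  show "refl_on (spheroids n X a) (spheroid_homotopy n X a)"
    by (auto simp: refl_on_def spheroid_homotopy_def spheroids_def)
  show "sym (spheroid_homotopy n X a)"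
    unfolding sym_def spheroid_homotopy_def by (auto intro: homotopic_with_symD)
  show "trans (spheroid_homotopy n X a)"
    unfolding trans_def spheroid_homotopy_def by (auto intro: homotopic_with_trans)
qed

lemma spheroid_homotopy_refl:
  "u \<in> spheroids n X a \<Longrightarrow> (u, u) \<in> spheroid_homotopy n X a"
  by (simp add: spheroid_homotopy_def spheroids_def)

lemma spheroid_homotopy_sym:
  "(u, v) \<in> spheroid_homotopy n X a \<Longrightarrow> (v, u) \<in> spheroid_homotopy n X a"
  by (meson equivE equiv_spheroid_homotopy symD)

lemma spheroid_homotopy_trans:
  "(u, v) \<in> spheroid_homotopy n X a \<Longrightarrow> (v, w) \<in> spheroid_homotopy n X a \<Longrightarrow>
    (u, w) \<in> spheroid_homotopy n X a"
  by (meson equivE equiv_spheroid_homotopy transD)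

lemma spheroid_homotopy_compose:
  assumes "(u, v) \<in> spheroid_homotopy n X a" "continuous_map X Y f"
  shows "(f \<circ> u, f \<circ> v) \<in> spheroid_homotopy n Y (f a)"
  using assms unfolding spheroid_homotopy_def
  by (auto intro: homotopic_with_compose_continuous_map_left)

lemma spheroids_compose:
  "u \<in> spheroids n X a \<Longrightarrow> continuous_map X Y f \<Longrightarrow> f \<circ> u \<in> spheroids n Y (f a)"
  by (auto simp: spheroids_def continuous_map_compose)

lemma equiv_path_component_of: "equiv (topspace X) {(x, y). path_component_of X x y}"
proof (rule equivI)
  show "{(x, y). path_component_of X x y} \<subseteq> topspace X \<times> topspace X"
    using path_component_in_topspace by fastforce
  show "refl_on (topspace X) {(x, y). path_component_of X x y}"
    by (auto simp: refl_on_def path_component_of_refl)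
  show "sym {(x, y). path_component_of X x y}"
    by (auto simp: sym_def path_component_of_sym)
  show "trans {(x, y). path_component_of X x y}"
    by (auto simp: trans_def intro: path_component_of_trans)
qed

lemma path_components_of_eq_quotient:
  "path_components_of X = topspace X // {(x, y). path_component_of X x y}"
  by (auto simp: path_components_of_def quotient_def)

text \<open>Bijectivity is split into injectivity and surjectivity, and for homotopy groups one base
  point at a time, because the cancellation arguments below treat these separately.\<close>

definition pi0_inj :: "'a topology \<Rightarrow> 'b topology \<Rightarrow> ('a \<Rightarrow> 'b) \<Rightarrow> bool" where
  "pi0_inj X Y f \<longleftrightarrow> (\<forall>x\<in>topspace X. \<forall>y\<in>topspace X.
     path_component_of Y (f x) (f y) \<longrightarrow> path_component_of X x y)"

definition pi0_surj :: "'a topology \<Rightarrow> 'b topology \<Rightarrow> ('a \<Rightarrow> 'b) \<Rightarrow> bool" where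
  "pi0_surj X Y f \<longleftrightarrow> (\<forall>y\<in>topspace Y. \<exists>x\<in>topspace X. path_component_of Y (f x) y)"

definition pi_inj :: "nat \<Rightarrow> 'a topology \<Rightarrow> 'b topology \<Rightarrow> ('a \<Rightarrow> 'b) \<Rightarrow> 'a \<Rightarrow> bool" where
  "pi_inj n X Y f a \<longleftrightarrow> (\<forall>u\<in>spheroids n X a. \<forall>v\<in>spheroids n X a.
     (f \<circ> u, f \<circ> v) \<in> spheroid_homotopy n Y (f a) \<longrightarrow> (u, v) \<in> spheroid_homotopy n X a)"

definition pi_surj :: "nat \<Rightarrow> 'a topology \<Rightarrow> 'b topology \<Rightarrow> ('a \<Rightarrow> 'b) \<Rightarrow> 'a \<Rightarrow> bool" where
  "pi_surj n X Y f a \<longleftrightarrow> (\<forall>v\<in>spheroids n Y (f a). \<exists>u\<in>spheroids n X a.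
     (f \<circ> u, v) \<in> spheroid_homotopy n Y (f a))"

lemma weak_homotopy_equivalence_iff:
  "weak_homotopy_equivalence X Y f \<longleftrightarrow>
    continuous_map X Y f \<and> pi0_inj X Y f \<and> pi0_surj X Y f \<and>
    (\<forall>n\<ge>1. \<forall>a\<in>topspace X. pi_inj n X Y f a \<and> pi_surj n X Y f a)"
proof (cases "continuous_map X Y f")
  case True
  have "path_component_of Y (f x) (f y)" if "path_component_of X x y" for x y
    using path_component_of_continuous_image [OF True that] .
  then have "bij_betw (\<lambda>c. {(x, y). path_component_of Y x y} `` (f ` c))
      (topspace X // {(x, y). path_component_of X x y})
      (topspace Y // {(x, y). path_component_of Y x y}) \<longleftrightarrow> pi0_inj X Y f \<and> pi0_surj X Y f"
    using bij_betw_quotients_iff [OF equiv_path_component_of [of X] equiv_path_component_of [of Y], of f]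
    unfolding pi0_inj_def pi0_surj_def by simp
  moreover have "path_components_map Y f = (\<lambda>c. {(x, y). path_component_of Y x y} `` (f ` c))"
    by (auto simp: path_components_map_def fun_eq_iff)
  ultimately have pi0: "bij_betw (path_components_map Y f) (path_components_of X) (path_components_of Y)
      \<longleftrightarrow> pi0_inj X Y f \<and> pi0_surj X Y f"
    by (simp only: path_components_of_eq_quotient)
  have "bij_betw (homotopy_group_map n Y (f a) f)
          (homotopy_group_set n X a) (homotopy_group_set n Y (f a))
      \<longleftrightarrow> pi_inj n X Y f a \<and> pi_surj n X Y f a" for n a
    using bij_betw_quotients_iff [OF equiv_spheroid_homotopy [of n X a]
        equiv_spheroid_homotopy [of n Y "f a"] spheroid_homotopy_compose [OF _ True]]
    unfolding homotopy_group_map_def homotopy_group_set_def pi_inj_def pi_surj_def .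
  with True pi0 show ?thesis
    unfolding weak_homotopy_equivalence_def by blast
qed (simp add: weak_homotopy_equivalence_def)

lemma weak_homotopy_equivalence_id: "weak_homotopy_equivalence X X (\<lambda>x. x)"
proof -
  have "pi0_surj X X (\<lambda>x. x)"
    unfolding pi0_surj_def by (metis path_component_of_refl)
  moreover have "pi_surj n X X (\<lambda>x. x) a" for n a
    unfolding pi_surj_def by (auto simp: o_def intro: spheroid_homotopy_refl)
  ultimately show ?thesis
    by (simp add: weak_homotopy_equivalence_iff pi0_inj_def pi_inj_def o_def)
qed

section \<open>Composition and cancellation of weak homotopy equivalences\<close>

lemma pi_inj_comp:
  assumes "pi_inj n X Y f a" "pi_inj n Y Z g (f a)" "continuous_map X Y f"
  shows "pi_inj n X Z (g \<circ> f) a"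
  using assms spheroids_compose [OF _ assms(3)] unfolding pi_inj_def by (simp add: comp_assoc)

lemma pi_inj_of_comp:
  assumes "pi_inj n X Z (g \<circ> f) a" "continuous_map Y Z g"
  shows "pi_inj n X Y f a"
  using assms(1) spheroid_homotopy_compose [OF _ assms(2)] unfolding pi_inj_def by (simp add: comp_assoc)

lemma pi_surj_comp:
  assumes f: "pi_surj n X Y f a" and g: "pi_surj n Y Z g (f a)" "continuous_map Y Z g"
  shows "pi_surj n X Z (g \<circ> f) a"
  unfolding pi_surj_def
proof
  fix w assume "w \<in> spheroids n Z ((g \<circ> f) a)"
  then obtain v where v: "v \<in> spheroids n Y (f a)" "(g \<circ> v, w) \<in> spheroid_homotopy n Z (g (f a))"
    using g(1) unfolding pi_surj_def by auto
  then obtain u where u: "u \<in> spheroids n X a" "(f \<circ> u, v) \<in> spheroid_homotopy n Y (f a)"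
    using f unfolding pi_surj_def by auto
  have "(g \<circ> (f \<circ> u), w) \<in> spheroid_homotopy n Z (g (f a))"
    using spheroid_homotopy_compose [OF u(2) g(2)] v(2) by (rule spheroid_homotopy_trans)
  then show "\<exists>u\<in>spheroids n X a. (g \<circ> f \<circ> u, w) \<in> spheroid_homotopy n Z ((g \<circ> f) a)"
    using u(1) by (auto simp: comp_assoc)
qed

text \<open>A spheroid hitting \<open>g \<circ> v\<close> under \<open>g \<circ> f\<close> is
  carried by \<open>f\<close> to a spheroid with the same class as \<open>v\<close> after applying
  \<open>g\<close>; injectivity of \<open>g\<close> then identifies the two.\<close>

lemma pi_surj_of_comp_inner:
  assumes gf: "pi_surj n X Z (g \<circ> f) a" and g: "pi_inj n Y Z g (f a)" "continuous_map Y Z g"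
    and f: "continuous_map X Y f"
  shows "pi_surj n X Y f a"
  unfolding pi_surj_def
proof
  fix v assume v: "v \<in> spheroids n Y (f a)"
  then have "g \<circ> v \<in> spheroids n Z ((g \<circ> f) a)" using spheroids_compose [OF v g(2)] by simp
  then obtain u where u: "u \<in> spheroids n X a"
      "(g \<circ> f \<circ> u, g \<circ> v) \<in> spheroid_homotopy n Z ((g \<circ> f) a)"
    using gf unfolding pi_surj_def by blast
  then have "(f \<circ> u, v) \<in> spheroid_homotopy n Y (f a)"
    using g(1) v spheroids_compose [OF u(1) f] unfolding pi_inj_def by (simp add: comp_assoc)
  then show "\<exists>u\<in>spheroids n X a. (f \<circ> u, v) \<in> spheroid_homotopy n Y (f a)" using u(1) by blast
qed

lemma weak_homotopy_equivalence_continuous: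
  "weak_homotopy_equivalence X Y f \<Longrightarrow> continuous_map X Y f"
  by (simp add: weak_homotopy_equivalence_def)

lemma weak_homotopy_equivalence_compose:
  assumes f: "weak_homotopy_equivalence X Y f" and g: "weak_homotopy_equivalence Y Z g"
  shows "weak_homotopy_equivalence X Z (g \<circ> f)"
proof -
  note cf = weak_homotopy_equivalence_continuous [OF f]
  note cg = weak_homotopy_equivalence_continuous [OF g]
  have fa: "f a \<in> topspace Y" if "a \<in> topspace X" for a
    using cf that by (auto simp: continuous_map_def)
  have "pi0_surj X Z (g \<circ> f)"
    unfolding pi0_surj_def
  proof
    fix z assume "z \<in> topspace Z"
    then obtain y where y: "y \<in> topspace Y" "path_component_of Z (g y) z"
      using g unfolding weak_homotopy_equivalence_iff pi0_surj_def by blast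
    then obtain x where x: "x \<in> topspace X" "path_component_of Y (f x) y"
      using f unfolding weak_homotopy_equivalence_iff pi0_surj_def by blast
    have "path_component_of Z (g (f x)) z"
      using path_component_of_continuous_image [OF cg x(2)] y(2) by (rule path_component_of_trans)
    then show "\<exists>x\<in>topspace X. path_component_of Z ((g \<circ> f) x) z" using x(1) by auto
  qed
  moreover have "pi0_inj X Z (g \<circ> f)"
    using f g fa unfolding weak_homotopy_equivalence_iff pi0_inj_def by simp
  moreover have "pi_inj n X Z (g \<circ> f) a \<and> pi_surj n X Z (g \<circ> f) a"
    if "n \<ge> 1" "a \<in> topspace X" for n a
    using f g fa that cf cg unfolding weak_homotopy_equivalence_iff
    by (blast intro: pi_inj_comp pi_surj_comp)
  ultimately show ?thesis
    using continuous_map_compose [OF cf cg] unfolding weak_homotopy_equivalence_iff by blast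
qed

text \<open>In this direction of two-out-of-three no change of base point occurs: the base points to
  be tested lie in \<open>X\<close>, and \<open>g\<close> is examined only at their images.\<close>

lemma weak_homotopy_equivalence_cancel_left:
  assumes gf: "weak_homotopy_equivalence X Z (g \<circ> f)" and g: "weak_homotopy_equivalence Y Z g"
    and f: "continuous_map X Y f"
  shows "weak_homotopy_equivalence X Y f"
proof -
  note cg = weak_homotopy_equivalence_continuous [OF g]
  have fa: "f a \<in> topspace Y" if "a \<in> topspace X" for a
    using f that by (auto simp: continuous_map_def)
  have "pi0_inj X Y f"
    using gf path_component_of_continuous_image [OF cg]
    unfolding weak_homotopy_equivalence_iff pi0_inj_def by simp
  moreover have "pi0_surj X Y f"
    unfolding pi0_surj_def
  proof
    fix y assume y: "y \<in> topspace Y"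
    then have "g y \<in> topspace Z" using cg by (auto simp: continuous_map_def)
    then obtain x where "x \<in> topspace X" "path_component_of Z (g (f x)) (g y)"
      using gf unfolding weak_homotopy_equivalence_iff pi0_surj_def by auto
    moreover have "path_component_of Y (f x) y" if "x \<in> topspace X"
        "path_component_of Z (g (f x)) (g y)" for x
      using g y fa that unfolding weak_homotopy_equivalence_iff pi0_inj_def by simp
    ultimately show "\<exists>x\<in>topspace X. path_component_of Y (f x) y" by blast
  qed
  moreover have "pi_inj n X Y f a \<and> pi_surj n X Y f a" if "n \<ge> 1" "a \<in> topspace X" for n a
  proof
    have "pi_inj n X Z (g \<circ> f) a"
      using gf that unfolding weak_homotopy_equivalence_iff by blast
    then show "pi_inj n X Y f a" by (rule pi_inj_of_comp [OF _ cg])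
    have "pi_inj n Y Z g (f a)" "pi_surj n X Z (g \<circ> f) a"
      using gf g that fa unfolding weak_homotopy_equivalence_iff by blast+
    then show "pi_surj n X Y f a"
      by (intro pi_surj_of_comp_inner [OF _ _ cg f])
  qed
  ultimately show ?thesis
    using f unfolding weak_homotopy_equivalence_iff by blast
qed

text \<open>The composites need not be homotopic to identities. Injectivity of \<open>f\<close>
  comes from \<open>g \<circ> f\<close>; surjectivity at \<open>a\<close> comes from
  \<open>g \<circ> f\<close> together with injectivity of \<open>g\<close> at \<open>f a\<close>,
  which in turn comes from \<open>f \<circ> g\<close>.\<close>

lemma weak_homotopy_equivalence_of_inverse:
  assumes gf: "weak_homotopy_equivalence X X (g \<circ> f)" and fg: "weak_homotopy_equivalence Y Y (f \<circ> g)"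
    and f: "continuous_map X Y f" and g: "continuous_map Y X g"
  shows "weak_homotopy_equivalence X Y f"
proof -
  have fa: "f a \<in> topspace Y" if "a \<in> topspace X" for a
    using f that by (auto simp: continuous_map_def)
  have ga: "g a \<in> topspace X" if "a \<in> topspace Y" for a
    using g that by (auto simp: continuous_map_def)
  have "pi0_inj X Y f"
    using gf path_component_of_continuous_image [OF g]
    unfolding weak_homotopy_equivalence_iff pi0_inj_def by simp
  moreover have "pi0_surj X Y f"
    using fg ga unfolding weak_homotopy_equivalence_iff pi0_surj_def by (metis comp_apply)
  moreover have "pi_inj n X Y f a" if "n \<ge> 1" "a \<in> topspace X" for n a
  proof (rule pi_inj_of_comp [OF _ g])
    show "pi_inj n X X (g \<circ> f) a"
      using gf that unfolding weak_homotopy_equivalence_iff by blast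
  qed
  moreover have "pi_surj n X Y f a" if "n \<ge> 1" "a \<in> topspace X" for n a
  proof -
    have "pi_inj n Y Y (f \<circ> g) (f a)"
      using fg that fa unfolding weak_homotopy_equivalence_iff by blast
    then have "pi_inj n Y X g (f a)" by (rule pi_inj_of_comp [OF _ f])
    then show ?thesis
      using gf that unfolding weak_homotopy_equivalence_iff
      by (intro pi_surj_of_comp_inner [OF _ _ g f]) auto
  qed
  ultimately show ?thesis
    using f unfolding weak_homotopy_equivalence_iff by blast
qed

section \<open>Homotopic maps and change of base point\<close>

text \<open>On the cube this is the distance to the nearest face. The value 1 in dimension 0 keeps
  the single point of the 0-cube, whose boundary is empty, away from the shell.\<close>

primrec cube_margin :: "nat \<Rightarrow> (nat \<Rightarrow> real) \<Rightarrow> real" where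
  "cube_margin 0 x = 1"
| "cube_margin (Suc k) x = min (cube_margin k x) (min (x k) (1 - x k))"

lemma continuous_map_cube_margin: "continuous_map (cube n) euclideanreal (cube_margin n)"
proof -
  have "continuous_map (cube n) euclideanreal (cube_margin k)" if "k \<le> n" for k
    using that
  proof (induction k)
    case (Suc k)
    then have "continuous_map (cube n) euclideanreal (\<lambda>x. x k)"
      by (intro continuous_map_cube_coord) simp
    with Suc show ?case
      by (simp, intro continuous_map_real_min continuous_map_diff) auto
  next
    case 0
    have "cube_margin 0 = (\<lambda>_. 1)" by auto
    then show ?case by simp
  qed
  then show ?thesis by simp
qed

lemma cube_margin_nonneg: "x \<in> topspace (cube n) \<Longrightarrow> 0 \<le> cube_margin n x"
proof -
  have "\<forall>i<k. x i \<in> {0..1} \<Longrightarrow> 0 \<le> cube_margin k x" for k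
    by (induction k) auto
  then show "x \<in> topspace (cube n) \<Longrightarrow> 0 \<le> cube_margin n x"
    by (auto simp: topspace_cube PiE_iff)
qed

lemma cube_margin_le: "i < n \<Longrightarrow> cube_margin n x \<le> x i \<and> cube_margin n x \<le> 1 - x i"
proof (induction n)
  case (Suc n)
  then show ?case by (cases "i = n") (auto simp: min_le_iff_disj)
qed simp

lemma cube_margin_attained:
  "cube_margin n x < 1 \<Longrightarrow> \<exists>i<n. cube_margin n x = x i \<or> cube_margin n x = 1 - x i"
proof (induction n)
  case (Suc n)
  consider "cube_margin (Suc n) x = cube_margin n x" | "cube_margin (Suc n) x = x n"
    | "cube_margin (Suc n) x = 1 - x n"
    unfolding cube_margin.simps by linarith
  then show ?case
  proof cases
    case 1
    then obtain i where "i < n" "cube_margin n x = x i \<or> cube_margin n x = 1 - x i"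
      using Suc by auto
    with 1 show ?thesis by (metis less_SucI)
  qed auto
qed simp

lemma cube_margin_boundary: "x \<in> cube_boundary n \<Longrightarrow> cube_margin n x = 0"
  using cube_margin_le [of _ n x] cube_margin_nonneg [of x n]
  unfolding cube_boundary_def by force

text \<open>
  The radial stretching of the concentric cube of side \<open>(1 + t) / 2\<close> onto the whole cube; the
  complementary shell goes to the boundary.
\<close>

definition cube_stretch :: "nat \<Rightarrow> real \<Rightarrow> (nat \<Rightarrow> real) \<Rightarrow> nat \<Rightarrow> real" where
  "cube_stretch n t x = restrict (\<lambda>i. max 0 (min 1 ((x i - 1/2) * (2 / (1 + t)) + 1/2))) {..<n}"

lemma cube_stretch_in_cube: "cube_stretch n t x \<in> topspace (cube n)"
  by (auto simp: cube_stretch_def topspace_cube)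

text \<open>The inner cube of side \<open>(1 + t) / 2\<close> leaves a layer of thickness
  \<open>(1 - t) / 4\<close> at each face; there the affine map leaves the unit interval and
  clipping takes over.\<close>

lemma cube_stretch_face:
  assumes t: "t \<in> {0..1}" and i: "i < n"
  shows "x i \<le> (1 - t) / 4 \<Longrightarrow> cube_stretch n t x i = 0"
    and "1 - x i \<le> (1 - t) / 4 \<Longrightarrow> cube_stretch n t x i = 1"
proof -
  have pos: "2 / (1 + t) > 0" using t by simp
  have eq: "(1 + t) / 4 * (2 / (1 + t)) = 1/2" using t by (simp add: field_simps)
  {
    assume "x i \<le> (1 - t) / 4"
    then have "x i - 1/2 \<le> - ((1 + t) / 4)" by (simp add: field_simps)
    then have "(x i - 1/2) * (2 / (1 + t)) \<le> - ((1 + t) / 4) * (2 / (1 + t))"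
      using pos by (intro mult_right_mono) auto
    then have "(x i - 1/2) * (2 / (1 + t)) + 1/2 \<le> 0" using eq by linarith
    then show "cube_stretch n t x i = 0" using i by (simp add: cube_stretch_def)
  next
    assume "1 - x i \<le> (1 - t) / 4"
    then have "(1 + t) / 4 \<le> x i - 1/2" by (simp add: field_simps)
    then have "(1 + t) / 4 * (2 / (1 + t)) \<le> (x i - 1/2) * (2 / (1 + t))"
      using pos by (intro mult_right_mono) auto
    then have "1 \<le> (x i - 1/2) * (2 / (1 + t)) + 1/2" using eq by linarith
    then show "cube_stretch n t x i = 1" using i by (simp add: cube_stretch_def)
  }
qed

lemma cube_stretch_shell:
  assumes "t \<in> {0..1}" "cube_margin n x \<le> (1 - t) / 4"
  shows "cube_stretch n t x \<in> cube_boundary n"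
proof -
  have "cube_margin n x < 1" using assms by auto
  then obtain i where i: "i < n" "cube_margin n x = x i \<or> cube_margin n x = 1 - x i"
    using cube_margin_attained by blast
  then have "cube_stretch n t x i = 0 \<or> cube_stretch n t x i = 1"
    using cube_stretch_face [OF assms(1) i(1)] assms(2) by auto
  then show ?thesis
    using i(1) cube_stretch_in_cube by (auto simp: cube_boundary_def)
qed

lemma cube_stretch_1: "x \<in> topspace (cube n) \<Longrightarrow> cube_stretch n 1 x = x"
  by (auto simp: cube_stretch_def topspace_cube PiE_iff fun_eq_iff extensional_def)

lemma continuous_map_cube_stretch:
  assumes \<tau>: "continuous_map T I01 \<tau>" and \<xi>: "continuous_map T (cube n) \<xi>"
  shows "continuous_map T (cube n) (\<lambda>z. cube_stretch n (\<tau> z) (\<xi> z))"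
  unfolding continuous_map_into_cube
proof (intro conjI ballI allI impI)
  show "cube_stretch n (\<tau> z) (\<xi> z) \<in> PiE {..<n} (\<lambda>_. {0..1})" for z
    using cube_stretch_in_cube by (simp add: topspace_cube)
  fix i assume i: "i < n"
  have \<tau>': "continuous_map T euclideanreal \<tau>" and \<tau>0: "z \<in> topspace T \<Longrightarrow> 0 \<le> \<tau> z" for z
    using \<tau> by (auto simp: continuous_map_in_subtopology)
  have "continuous_map T euclideanreal (\<lambda>z. \<xi> z i)"
    using \<xi> i by (simp add: continuous_map_into_cube)
  moreover have "1 + \<tau> z \<noteq> 0" if "z \<in> topspace T" for z
    using \<tau>0 [OF that] by linarith
  ultimately have "continuous_map T euclideanreal
      (\<lambda>z. max 0 (min 1 ((\<xi> z i - 1/2) * (2 / (1 + \<tau> z)) + 1/2)))"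
    using \<tau>'
    by (intro continuous_map_real_max continuous_map_real_min continuous_map_add
        continuous_map_real_mult continuous_map_diff continuous_map_real_divide) auto
  then show "continuous_map T euclideanreal (\<lambda>z. cube_stretch n (\<tau> z) (\<xi> z) i)"
    using i by (simp add: cube_stretch_def)
qed

text \<open>
  At \<open>t = 0\<close> this is the usual transport of the spheroid \<open>v\<close> along the path \<open>c\<close> towards its
  starting point, and \<open>t = 1\<close> gives back \<open>v\<close>.
\<close>

definition drag :: "nat \<Rightarrow> (real \<Rightarrow> 'a) \<Rightarrow> ((nat \<Rightarrow> real) \<Rightarrow> 'a) \<Rightarrow> real \<Rightarrow> (nat \<Rightarrow> real) \<Rightarrow> 'a" where
  "drag n c v t x = (if (1 - t) / 4 \<le> cube_margin n x then v (cube_stretch n t x)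
     else c (t + 4 * cube_margin n x))"

text \<open>The branches are glued where the margin equals \<open>(1 - t) / 4\<close>. All arguments
  are maps on a parameter space \<open>T\<close>, so that one proof covers both the homotopy in
  \<open>t\<close> and the homotopy between two transported spheroids.\<close>

lemma continuous_map_drag:
  assumes c: "continuous_map I01 Y c"
    and V: "continuous_map (prod_topology I01 (cube n)) Y V"
    and Vc: "\<And>s x. s \<in> {0..1} \<Longrightarrow> x \<in> cube_boundary n \<Longrightarrow> V (s, x) = c 1"
    and \<tau>: "continuous_map T I01 \<tau>" and \<sigma>: "continuous_map T I01 \<sigma>"
    and \<xi>: "continuous_map T (cube n) \<xi>"
  shows "continuous_map T Y (\<lambda>z. drag n c (\<lambda>x. V (\<sigma> z, x)) (\<tau> z) (\<xi> z))"
  unfolding drag_def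
proof (rule continuous_map_cases_le)
  have \<tau>': "continuous_map T euclideanreal \<tau>" and \<tau>01: "z \<in> topspace T \<Longrightarrow> \<tau> z \<in> {0..1}" for z
    using \<tau> by (auto simp: continuous_map_in_subtopology)
  have m: "continuous_map T euclideanreal (\<lambda>z. cube_margin n (\<xi> z))"
    using continuous_map_compose [OF \<xi> continuous_map_cube_margin] by (simp add: o_def)
  have \<xi>c: "\<xi> z \<in> topspace (cube n)" if "z \<in> topspace T" for z
    using \<xi> that by (auto simp: continuous_map_def)
  show "continuous_map T euclideanreal (\<lambda>z. (1 - \<tau> z) / 4)"
    using \<tau>' by (intro continuous_map_real_divide continuous_map_diff) auto
  show "continuous_map T euclideanreal (\<lambda>z. cube_margin n (\<xi> z))" by (rule m)
  have "continuous_map T Y (\<lambda>z. V (\<sigma> z, cube_stretch n (\<tau> z) (\<xi> z)))"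
    using continuous_map_compose [OF _ V, of T "\<lambda>z. (\<sigma> z, cube_stretch n (\<tau> z) (\<xi> z))"]
      continuous_map_cube_stretch [OF \<tau> \<xi>] \<sigma>
    by (simp add: continuous_map_paired o_def)
  then show "continuous_map (subtopology T {z \<in> topspace T. (1 - \<tau> z) / 4 \<le> cube_margin n (\<xi> z)}) Y
      (\<lambda>z. V (\<sigma> z, cube_stretch n (\<tau> z) (\<xi> z)))"
    by (rule continuous_map_from_subtopology)
  let ?T' = "subtopology T {z \<in> topspace T. cube_margin n (\<xi> z) \<le> (1 - \<tau> z) / 4}"
  have "continuous_map T euclideanreal (\<lambda>z. \<tau> z + 4 * cube_margin n (\<xi> z))"
    using \<tau>' m by (intro continuous_map_add continuous_map_real_mult) auto
  moreover have "\<tau> z + 4 * cube_margin n (\<xi> z) \<in> {0..1}"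
    if "z \<in> topspace T" "cube_margin n (\<xi> z) \<le> (1 - \<tau> z) / 4" for z
    using \<tau>01 [OF that(1)] cube_margin_nonneg [OF \<xi>c [OF that(1)]] that(2) by auto
  ultimately have "continuous_map ?T' I01 (\<lambda>z. \<tau> z + 4 * cube_margin n (\<xi> z))"
    by (auto simp: continuous_map_in_subtopology continuous_map_from_subtopology)
  from continuous_map_compose [OF this c]
  show "continuous_map ?T' Y (\<lambda>z. c (\<tau> z + 4 * cube_margin n (\<xi> z)))"
    by (simp add: o_def)
  \<comment> \<open>On the interface the stretched point lies on the boundary and the path parameter
    is 1, so both branches give \<open>c 1\<close>.\<close>
  fix z assume z: "z \<in> topspace T" and eq: "(1 - \<tau> z) / 4 = cube_margin n (\<xi> z)"
  have "cube_stretch n (\<tau> z) (\<xi> z) \<in> cube_boundary n"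
    using cube_stretch_shell [OF \<tau>01 [OF z]] eq by simp
  moreover have "\<sigma> z \<in> {0..1}" using \<sigma> z by (auto simp: continuous_map_in_subtopology)
  moreover have "\<tau> z + 4 * cube_margin n (\<xi> z) = 1" unfolding eq [symmetric] by (simp add: field_simps)
  ultimately show "V (\<sigma> z, cube_stretch n (\<tau> z) (\<xi> z)) = c (\<tau> z + 4 * cube_margin n (\<xi> z))"
    using Vc by simp
qed

lemma drag_boundary:
  assumes "t \<in> {0..1}" "x \<in> cube_boundary n" "\<And>y. y \<in> cube_boundary n \<Longrightarrow> v y = c 1"
  shows "drag n c v t x = c t"
proof -
  have m: "cube_margin n x = 0" by (rule cube_margin_boundary) fact
  show ?thesis
  \<comment> \<open>At \<open>t = 1\<close> the shell has thickness 0 and boundary points fall into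
    the first branch of \<open>drag\<close>; for smaller \<open>t\<close> they fall into the
    second.\<close>
  proof (cases "t = 1")
    case True
    then have "cube_stretch n t x = x"
      using cube_stretch_1 cube_boundary_subset assms(2) by blast
    with True m show ?thesis using assms(2,3) by (simp add: drag_def)
  next
    case False
    then show ?thesis using assms(1) m by (simp add: drag_def)
  qed
qed

lemma drag_1: "x \<in> topspace (cube n) \<Longrightarrow> drag n c v 1 x = v x"
  using cube_margin_nonneg [of x n] by (simp add: drag_def cube_stretch_1)

section \<open>Free homotopies of spheroids along a path of base points\<close>

text \<open>The whole boundary of the cube follows \<open>c\<close> simultaneously. This relation
  compares homotopy groups at \<open>c 0\<close> and \<open>c 1\<close> without introducing an
  isomorphism between them.\<close>

definition homotopic_along ::
  "nat \<Rightarrow> 'a topology \<Rightarrow> (real \<Rightarrow> 'a) \<Rightarrow> ((nat \<Rightarrow> real) \<Rightarrow> 'a) \<Rightarrow> ((nat \<Rightarrow> real) \<Rightarrow> 'a) \<Rightarrow> bool" where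
  "homotopic_along n Y c u v \<longleftrightarrow>
     (\<exists>G. continuous_map (prod_topology I01 (cube n)) Y G \<and>
       (\<forall>x\<in>topspace (cube n). G (0, x) = u x \<and> G (1, x) = v x) \<and>
       (\<forall>t\<in>{0..1}. \<forall>x\<in>cube_boundary n. G (t, x) = c t))"

lemma homotopic_along_reverse:
  assumes "homotopic_along n Y c u v"
  shows "homotopic_along n Y (\<lambda>t. c (1 - t)) v u"
proof -
  obtain G where G: "continuous_map (prod_topology I01 (cube n)) Y G"
    "\<forall>x\<in>topspace (cube n). G (0, x) = u x \<and> G (1, x) = v x"
    "\<forall>t\<in>{0..1}. \<forall>x\<in>cube_boundary n. G (t, x) = c t"
    using assms unfolding homotopic_along_def by blast
  have "continuous_map (prod_topology I01 (cube n)) I01 (\<lambda>z. 1 - fst z)"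
    using continuous_map_fst [of I01 "cube n"]
    by (auto simp: continuous_map_in_subtopology intro!: continuous_map_diff)
  then have "continuous_map (prod_topology I01 (cube n)) (prod_topology I01 (cube n)) (\<lambda>z. (1 - fst z, snd z))"
    by (simp add: continuous_map_paired continuous_map_snd)
  from continuous_map_compose [OF this G(1)]
  have "continuous_map (prod_topology I01 (cube n)) Y (\<lambda>z. G (1 - fst z, snd z))" by (simp add: o_def)
  then show ?thesis
    unfolding homotopic_along_def using G(2,3)
    by (intro exI [of _ "\<lambda>z. G (1 - fst z, snd z)"]) auto
qed

lemma homotopic_along_drag:
  assumes c: "continuous_map I01 Y c" and v: "v \<in> spheroids n Y (c 1)"
  shows "homotopic_along n Y c (drag n c v 0) v"
proof -
  have V: "continuous_map (prod_topology I01 (cube n)) Y (v \<circ> snd)"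
    using v by (intro continuous_map_compose [OF continuous_map_snd]) (simp add: spheroids_def)
  have vb: "v y = c 1" if "y \<in> cube_boundary n" for y
    using v that by (simp add: spheroids_def)
  have "continuous_map (prod_topology I01 (cube n)) Y
      (\<lambda>z. drag n c (\<lambda>x. (v \<circ> snd) (fst z, x)) (fst z) (snd z))"
    by (rule continuous_map_drag [OF c V _ continuous_map_fst continuous_map_fst continuous_map_snd])
      (simp add: vb)
  then have "continuous_map (prod_topology I01 (cube n)) Y (\<lambda>z. drag n c v (fst z) (snd z))"
    by simp
  then show ?thesis
    unfolding homotopic_along_def using drag_1 drag_boundary [where v = v and c = c] vb
    by (intro exI [of _ "\<lambda>z. drag n c v (fst z) (snd z)"]) auto
qed

lemma homotopic_along_imp_spheroids:
  assumes "homotopic_along n Y c u v"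
  shows "u \<in> spheroids n Y (c 0)" "v \<in> spheroids n Y (c 1)"
proof -
  obtain G where G: "continuous_map (prod_topology I01 (cube n)) Y G"
    "\<forall>x\<in>topspace (cube n). G (0, x) = u x \<and> G (1, x) = v x"
    "\<forall>t\<in>{0..1}. \<forall>x\<in>cube_boundary n. G (t, x) = c t"
    using assms unfolding homotopic_along_def by blast
  have slice: "continuous_map (cube n) Y (\<lambda>x. G (t, x))" if "t \<in> {0..1}" for t
    using continuous_map_o_Pair [OF G(1), of t] that by (simp add: o_def)
  have "continuous_map (cube n) Y u" "continuous_map (cube n) Y v"
    using slice [of 0] slice [of 1] G(2) by (auto intro: continuous_map_eq)
  moreover have "u x = c 0" "v x = c 1" if "x \<in> cube_boundary n" for x
    using G(2,3) that cube_boundary_subset [OF that] by (metis atLeastAtMost_iff order_refl zero_le_one)+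
  ultimately show "u \<in> spheroids n Y (c 0)" "v \<in> spheroids n Y (c 1)"
    by (simp_all add: spheroids_def)
qed

text \<open>A free homotopy along \<open>c\<close> determines its start as the transport of its end.
  Both spheroids are \<open>G\<close> precomposed with maps from the cube into the cylinder, and a
  deformation between these maps keeps the boundary of the cube in the boundary at time 0.\<close>

lemma spheroid_homotopy_drag_start:
  assumes "homotopic_along n Y c u v"
  shows "(u, drag n c v 0) \<in> spheroid_homotopy n Y (c 0)"
proof -
  obtain G where G: "continuous_map (prod_topology I01 (cube n)) Y G"
    "\<forall>x\<in>topspace (cube n). G (0, x) = u x \<and> G (1, x) = v x"
    "\<forall>t\<in>{0..1}. \<forall>x\<in>cube_boundary n. G (t, x) = c t"
    using assms unfolding homotopic_along_def by blast
  let ?I = "prod_topology I01 (cube n)"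
  \<comment> \<open>The straight line in the cylinder from \<open>(0, x)\<close>, where
    \<open>G\<close> is \<open>u\<close>, to the point with time
    \<open>min 1 (4 * cube_margin n x)\<close> and position \<open>cube_stretch n 0 x\<close>, where
    \<open>G\<close> is the transported \<open>v\<close>.\<close>
  define \<tau> where "\<tau> = (\<lambda>z. fst z * min 1 (4 * cube_margin n (snd z)))"
  define \<xi> where "\<xi> = (\<lambda>z :: real \<times> (nat \<Rightarrow> real).
      restrict (\<lambda>i. (1 - fst z) * snd z i + fst z * cube_stretch n 0 (snd z) i) {..<n})"
  have fst': "continuous_map ?I euclideanreal fst"
    using continuous_map_fst [of I01 "cube n"] by (simp add: continuous_map_in_subtopology)
  have coord: "continuous_map ?I euclideanreal (\<lambda>z. snd z i)" if "i < n" for i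
    using continuous_map_snd [of I01 "cube n"] that by (simp add: continuous_map_into_cube)
  have const0: "continuous_map ?I I01 (\<lambda>_. 0)" by simp
  have coord': "continuous_map ?I euclideanreal (\<lambda>z. cube_stretch n 0 (snd z) i)" if "i < n" for i
    using continuous_map_cube_stretch [OF const0 continuous_map_snd] that
    by (simp add: continuous_map_into_cube)
  have m: "continuous_map ?I euclideanreal (\<lambda>z. cube_margin n (snd z))"
    using continuous_map_compose [OF continuous_map_snd continuous_map_cube_margin] by (simp add: o_def)
  have "continuous_map ?I euclideanreal \<tau>"
    unfolding \<tau>_def using fst' m
    by (intro continuous_map_real_mult continuous_map_real_min) auto
  moreover have "\<tau> z \<in> {0..1}" if "z \<in> topspace ?I" for z
  proof -
    have "0 \<le> min 1 (4 * cube_margin n (snd z))" "min 1 (4 * cube_margin n (snd z)) \<le> 1"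
      using that cube_margin_nonneg [of "snd z" n] by auto
    moreover have "0 \<le> fst z" "fst z \<le> 1" using that by auto
    ultimately show ?thesis unfolding \<tau>_def by (simp add: mult_le_one)
  qed
  ultimately have "continuous_map ?I I01 \<tau>"
    by (auto simp: continuous_map_in_subtopology)
  moreover have "continuous_map ?I (cube n) \<xi>"
    unfolding continuous_map_into_cube
  proof (intro conjI ballI allI impI)
    fix z assume z: "z \<in> topspace ?I"
    have "(1 - fst z) * snd z i + fst z * cube_stretch n 0 (snd z) i \<in> {0..1}" if "i < n" for i
    proof -
      have "snd z i \<in> {0..1}" "cube_stretch n 0 (snd z) i \<in> {0..1}"
        using z that cube_stretch_in_cube [of n 0 "snd z"] by (auto simp: topspace_cube PiE_iff)
      moreover have "fst z \<in> {0..1}" using z by auto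
      ultimately show ?thesis
        using convex_bound_le [of "snd z i" 1 "cube_stretch n 0 (snd z) i" "1 - fst z" "fst z"] by auto
    qed
    then show "\<xi> z \<in> PiE {..<n} (\<lambda>_. {0..1})" by (simp add: \<xi>_def)
  next
    fix i assume "i < n"
    then show "continuous_map ?I euclideanreal (\<lambda>z. \<xi> z i)"
      using fst' coord coord' unfolding \<xi>_def
      by (simp, intro continuous_map_add continuous_map_real_mult continuous_map_diff) auto
  qed
  ultimately have "continuous_map ?I ?I (\<lambda>z. (\<tau> z, \<xi> z))" by (simp add: continuous_map_paired)
  from continuous_map_compose [OF this G(1)]
  have cont: "continuous_map ?I Y (\<lambda>z. G (\<tau> z, \<xi> z))" by (simp add: o_def)
  have start: "G (\<tau> (0, x), \<xi> (0, x)) = u x" if x: "x \<in> topspace (cube n)" for x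
  proof -
    have "\<xi> (0, x) = x" "\<tau> (0, x) = 0"
      using x by (auto simp: \<xi>_def \<tau>_def topspace_cube PiE_iff extensional_def fun_eq_iff)
    then show ?thesis using G(2) x by simp
  qed
  have stop: "G (\<tau> (1, x), \<xi> (1, x)) = drag n c v 0 x" if x: "x \<in> topspace (cube n)" for x
  proof -
    have \<xi>: "\<xi> (1, x) = cube_stretch n 0 x"
      using cube_stretch_in_cube [of n 0 x]
      by (auto simp: \<xi>_def topspace_cube PiE_iff extensional_def fun_eq_iff)
    show ?thesis
    \<comment> \<open>In the inner cube the time is 1, so \<open>G\<close> returns \<open>v\<close>;
      in the shell the position lies on the boundary, so \<open>G\<close> returns the value of
      \<open>c\<close> at the time reached.\<close>
    proof (cases "1 / 4 \<le> cube_margin n x")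
      case True
      then have "\<tau> (1, x) = 1" by (simp add: \<tau>_def)
      then show ?thesis using True \<xi> G(2) cube_stretch_in_cube by (simp add: drag_def)
    next
      case False
      then have \<tau>: "\<tau> (1, x) = 4 * cube_margin n x" by (simp add: \<tau>_def)
      have "cube_stretch n 0 x \<in> cube_boundary n" using False by (intro cube_stretch_shell) auto
      moreover have "4 * cube_margin n x \<in> {0..1}" using False cube_margin_nonneg [OF x] by simp
      ultimately show ?thesis using False \<xi> \<tau> G(3) by (simp add: drag_def)
    qed
  qed
  have bdry: "G (\<tau> (t, x), \<xi> (t, x)) = c 0" if t: "t \<in> {0..1}" and x: "x \<in> cube_boundary n" for t x
  proof -
    have "\<tau> (t, x) = 0" using cube_margin_boundary [OF x] by (simp add: \<tau>_def)
    \<comment> \<open>A coordinate equal to 0 or 1 is fixed by the stretching, hence by the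
      interpolation, so the point stays on its face.\<close>
    moreover have "\<xi> (t, x) \<in> cube_boundary n"
    proof -
      obtain i where i: "i < n" "x i = 0 \<or> x i = 1" using x by (auto simp: cube_boundary_def)
      then have "cube_stretch n 0 x i = x i"
        using cube_stretch_face [of 0 i n x] by auto
      then have "\<xi> (t, x) i = x i" using i(1) by (simp add: \<xi>_def algebra_simps)
      moreover have "\<xi> (t, x) \<in> topspace (cube n)"
        using \<open>continuous_map ?I (cube n) \<xi>\<close> t cube_boundary_subset [OF x]
        by (auto simp: continuous_map_def)
      ultimately show ?thesis using i by (auto simp: cube_boundary_def)
    qed
    ultimately show ?thesis using G(3) by simp
  qed
  show ?thesis
    unfolding spheroid_homotopy_iff
    using cont start stop bdry by (intro exI [of _ "\<lambda>z. G (\<tau> z, \<xi> z)"]) auto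
qed

text \<open>The homotopy is transported slice by slice: its parameter is the argument
  \<open>\<sigma>\<close> of \<open>continuous_map_drag\<close>, while \<open>\<tau>\<close> is
  constantly 0.\<close>

lemma spheroid_homotopy_drag:
  assumes c: "continuous_map I01 Y c" and vv': "(v, v') \<in> spheroid_homotopy n Y (c 1)"
  shows "(drag n c v 0, drag n c v' 0) \<in> spheroid_homotopy n Y (c 0)"
proof -
  obtain V where V: "continuous_map (prod_topology I01 (cube n)) Y V"
      "\<forall>x\<in>topspace (cube n). V (0, x) = v x" "\<forall>x\<in>topspace (cube n). V (1, x) = v' x"
      "\<forall>t\<in>{0..1}. \<forall>x\<in>cube_boundary n. V (t, x) = c 1"
    using vv' unfolding spheroid_homotopy_iff by blast
  let ?h = "\<lambda>z. drag n c (\<lambda>x. V (fst z, x)) 0 (snd z)"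
  have "continuous_map (prod_topology I01 (cube n)) Y ?h"
    by (rule continuous_map_drag [OF c V(1) _ _ continuous_map_fst continuous_map_snd, of "\<lambda>_. 0"])
      (use V(4) in auto)
  moreover have "?h (t, x) = c 0" if "t \<in> {0..1}" "x \<in> cube_boundary n" for t x
    using that V(4) by (simp add: drag_boundary)
  ultimately show ?thesis
    unfolding spheroid_homotopy_iff using V(2,3) cube_stretch_in_cube
    by (intro exI [of _ ?h]) (auto simp: drag_def)
qed

lemma homotopic_along_start_unique:
  assumes c: "continuous_map I01 Y c"
    and "homotopic_along n Y c u v" "homotopic_along n Y c u' v'"
    and "(v, v') \<in> spheroid_homotopy n Y (c 1)"
  shows "(u, u') \<in> spheroid_homotopy n Y (c 0)"
  using assms spheroid_homotopy_drag_start spheroid_homotopy_drag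
    spheroid_homotopy_sym spheroid_homotopy_trans by meson

lemma continuous_map_reverse_path:
  assumes "continuous_map I01 Y c"
  shows "continuous_map I01 Y (\<lambda>t. c (1 - t))"
proof -
  have "continuous_map I01 I01 (\<lambda>t. 1 - t)"
    by (auto simp: continuous_map_in_subtopology intro!: continuous_intros)
  from continuous_map_compose [OF this assms] show ?thesis by (simp add: o_def)
qed

text \<open>
  Homotopies are only tested on cubes, which is all that homotopy groups see; this avoids the
  question whether a cylinder carries the right topology.
\<close>

definition cubewise_homotopy ::
  "'a topology \<Rightarrow> 'b topology \<Rightarrow> ('a \<Rightarrow> real \<Rightarrow> 'b) \<Rightarrow> ('a \<Rightarrow> 'b) \<Rightarrow> ('a \<Rightarrow> 'b) \<Rightarrow> bool" where
  "cubewise_homotopy X Y H f g \<longleftrightarrow>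
     (\<forall>n u. continuous_map (cube n) X u \<longrightarrow>
        continuous_map (prod_topology I01 (cube n)) Y (\<lambda>(t, x). H (u x) t)) \<and>
     (\<forall>x\<in>topspace X. H x 0 = f x \<and> H x 1 = g x)"

text \<open>The track of the base point carries \<open>f \<circ> u\<close> to
  \<open>g \<circ> u\<close>. For injectivity, relations at \<open>g a\<close> are moved back to
  \<open>f a\<close>. For surjectivity, \<open>v\<close> is transported to \<open>f a\<close>,
  represented there by some \<open>u\<close>, and the result returned along the reversed
  track.\<close>

lemma weak_homotopy_equivalence_homotopic:
  assumes f: "weak_homotopy_equivalence X Y f" and g: "continuous_map X Y g"
    and H: "cubewise_homotopy X Y H f g"
  shows "weak_homotopy_equivalence X Y g"
proof -
  have H_cont: "continuous_map (prod_topology I01 (cube n)) Y (\<lambda>(t, x). H (u x) t)"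
    if "continuous_map (cube n) X u" for n u
    using H that unfolding cubewise_homotopy_def by blast
  have H01: "H x 0 = f x" "H x 1 = g x" if "x \<in> topspace X" for x
    using H that unfolding cubewise_homotopy_def by blast+
  have track: "continuous_map I01 Y (H a)" if a: "a \<in> topspace X" for a
  proof -
    \<comment> \<open>The track of a point is the homotopy tested on the 0-cube, whose only point is
      \<open>\<lambda>_. undefined\<close>.\<close>
    have "continuous_map (cube 0) X (\<lambda>_. a)" using a by simp
    from H_cont [OF this]
    have "continuous_map (prod_topology I01 (cube 0)) Y (\<lambda>(t, x). H a t)" .
    moreover have "continuous_map I01 (prod_topology I01 (cube 0)) (\<lambda>t. (t, \<lambda>_. undefined))"
      by (simp add: continuous_map_paired topspace_cube)
    ultimately show ?thesis
      using continuous_map_compose by (force simp: o_def)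
  qed
  have pc: "path_component_of Y (f x) (g x)" if "x \<in> topspace X" for x
    unfolding path_component_of_def pathin_def using track [OF that] H01 [OF that] by blast
  have along: "homotopic_along n Y (H a) (f \<circ> u) (g \<circ> u)" if "u \<in> spheroids n X a" for n a u
  proof -
    have u: "continuous_map (cube n) X u" "\<And>x. x \<in> cube_boundary n \<Longrightarrow> u x = a"
      using that by (auto simp: spheroids_def)
    have "u x \<in> topspace X" if "x \<in> topspace (cube n)" for x
      using u(1) that by (auto simp: continuous_map_def)
    then show ?thesis
      unfolding homotopic_along_def using H_cont [OF u(1)] H01 u(2)
      by (intro exI [of _ "\<lambda>(t, x). H (u x) t"]) auto
  qed
  have "pi0_inj X Y g"
    unfolding pi0_inj_def
  proof (intro ballI impI)
    fix x y assume xy: "x \<in> topspace X" "y \<in> topspace X" "path_component_of Y (g x) (g y)"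
    have "path_component_of Y (f x) (f y)"
      using pc [OF xy(1)] pc [OF xy(2)] xy(3)
      by (meson path_component_of_sym path_component_of_trans)
    then show "path_component_of X x y"
      using f xy unfolding weak_homotopy_equivalence_iff pi0_inj_def by blast
  qed
  moreover have "pi0_surj X Y g"
    unfolding pi0_surj_def
  proof
    fix y assume "y \<in> topspace Y"
    then obtain x where x: "x \<in> topspace X" "path_component_of Y (f x) y"
      using f unfolding weak_homotopy_equivalence_iff pi0_surj_def by blast
    then have "path_component_of Y (g x) y"
      using pc by (meson path_component_of_sym path_component_of_trans)
    with x(1) show "\<exists>x\<in>topspace X. path_component_of Y (g x) y" by blast
  qed
  moreover have "pi_inj n X Y g a" if n: "n \<ge> 1" and a: "a \<in> topspace X" for n a
    unfolding pi_inj_def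
  proof (intro ballI impI)
    fix u v assume u: "u \<in> spheroids n X a" and v: "v \<in> spheroids n X a"
      and "(g \<circ> u, g \<circ> v) \<in> spheroid_homotopy n Y (g a)"
    then have "(f \<circ> u, f \<circ> v) \<in> spheroid_homotopy n Y (H a 0)"
      using homotopic_along_start_unique [OF track [OF a] along [OF u] along [OF v]] H01 [OF a] by simp
    then show "(u, v) \<in> spheroid_homotopy n X a"
      using f n a u v H01 [OF a] unfolding weak_homotopy_equivalence_iff pi_inj_def by simp
  qed
  moreover have "pi_surj n X Y g a" if n: "n \<ge> 1" and a: "a \<in> topspace X" for n a
    unfolding pi_surj_def
  proof
    fix v assume "v \<in> spheroids n Y (g a)"
    then have "homotopic_along n Y (H a) (drag n (H a) v 0) v"
      using homotopic_along_drag [OF track [OF a]] H01 [OF a] by simp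
    note v = this
    then have "drag n (H a) v 0 \<in> spheroids n Y (f a)"
      using homotopic_along_imp_spheroids(1) H01 [OF a] by metis
    then obtain u where u: "u \<in> spheroids n X a"
        "(f \<circ> u, drag n (H a) v 0) \<in> spheroid_homotopy n Y (f a)"
      using f n a unfolding weak_homotopy_equivalence_iff pi_surj_def by blast
    \<comment> \<open>The base point is written as the start of the reversed track, at parameter 0;
      it equals \<open>g a\<close>.\<close>
    have "(g \<circ> u, v) \<in> spheroid_homotopy n Y (H a (1 - 0))"
      by (rule homotopic_along_start_unique [OF continuous_map_reverse_path [OF track [OF a]]
            homotopic_along_reverse [OF along [OF u(1)]] homotopic_along_reverse [OF v]])
        (use u(2) H01 [OF a] in simp)
    then show "\<exists>u\<in>spheroids n X a. (g \<circ> u, v) \<in> spheroid_homotopy n Y (g a)"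
      using u(1) H01 [OF a] by auto
  qed
  ultimately show ?thesis
    using g unfolding weak_homotopy_equivalence_iff by blast
qed

lemma weak_homotopy_equivalence_cong:
  assumes f: "weak_homotopy_equivalence X Y f" and eq: "\<And>x. x \<in> topspace X \<Longrightarrow> f x = g x"
  shows "weak_homotopy_equivalence X Y g"
proof (rule weak_homotopy_equivalence_homotopic [OF f])
  note cf = weak_homotopy_equivalence_continuous [OF f]
  show "continuous_map X Y g" using cf eq by (rule continuous_map_eq)
  \<comment> \<open>Since \<open>f\<close> and \<open>g\<close> agree on the points of
    \<open>X\<close>, the constant homotopy connects them.\<close>
  show "cubewise_homotopy X Y (\<lambda>x t. f x) f g"
    unfolding cubewise_homotopy_def
    using eq continuous_map_compose [OF continuous_map_compose [OF continuous_map_snd] cf]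
    by (auto simp: o_def case_prod_unfold)
qed

lemma weak_homotopy_equivalence_homeomorphic:
  assumes "homeomorphic_maps X Y f g"
  shows "weak_homotopy_equivalence X Y f"
proof (rule weak_homotopy_equivalence_of_inverse)
  show "weak_homotopy_equivalence X X (g \<circ> f)" "weak_homotopy_equivalence Y Y (f \<circ> g)"
    using assms by (auto simp: homeomorphic_maps_def
        intro!: weak_homotopy_equivalence_cong [OF weak_homotopy_equivalence_id])
qed (use assms in \<open>auto simp: homeomorphic_maps_def\<close>)

section \<open>Mapping path spaces\<close>

text \<open>One outer kelleyfication suffices, since simplices have the same continuous maps into
  \<open>compact_open_paths Y\<close> and into its kelleyfication.\<close>

definition mapping_path_space ::
  "'v topology \<Rightarrow> 'y topology \<Rightarrow> ('v \<Rightarrow> 'y) \<Rightarrow> ('v \<times> (real \<Rightarrow> 'y)) topology" where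
  "mapping_path_space V Y f = Delta_kelleyfication
     (subtopology (prod_topology V (compact_open_paths Y)) {(v, \<gamma>). \<gamma> 0 = f v})"

lemma topspace_mapping_path_space:
  "topspace (mapping_path_space V Y f) = {(v, \<gamma>). v \<in> topspace V \<and> \<gamma> \<in> paths_in Y \<and> \<gamma> 0 = f v}"
  by (auto simp: mapping_path_space_def)

lemma continuous_map_into_mapping_path_space:
  assumes "Delta_generated T"
  shows "continuous_map T (mapping_path_space V Y f) g \<longleftrightarrow>
    continuous_map T V (\<lambda>x. fst (g x)) \<and> continuous_map T (compact_open_paths Y) (\<lambda>x. snd (g x)) \<and>
    (\<forall>x\<in>topspace T. snd (g x) 0 = f (fst (g x)))"
  unfolding mapping_path_space_def continuous_map_into_Delta_kelleyfication [OF assms]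
    continuous_map_in_subtopology continuous_map_pairwise
  by (auto simp: o_def case_prod_unfold)

lemma continuous_map_mapping_path_space:
  "continuous_map (mapping_path_space V Y f) V fst"
  "continuous_map (mapping_path_space V Y f) (compact_open_paths Y) snd"
  unfolding mapping_path_space_def
  by (intro continuous_map_from_Delta_kelleyfication continuous_map_from_subtopology
      continuous_map_fst continuous_map_snd)+

lemma Delta_generated_mapping_path_space: "Delta_generated (mapping_path_space V Y f)"
  unfolding mapping_path_space_def by (rule Delta_generated_Delta_kelleyfication)

lemma continuous_map_mapping_path_space_eval:
  "continuous_map (mapping_path_space V Y f) Y (\<lambda>z. snd z 1)"
  by (rule continuous_map_eval [OF continuous_map_mapping_path_space(2)]) simp

text \<open>A homotopy of end points is lifted by appending to each path the part of the homotopy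
  traversed so far; the starting point and the component in \<open>V\<close> do not move.\<close>

lemma Serre_fibration_mapping_path_space:
  "Serre_fibration (mapping_path_space V Y f) Y (\<lambda>z. snd z 1)"
  unfolding Serre_fibration_def
proof (intro conjI allI impI)
  let ?N = "mapping_path_space V Y f"
  show "continuous_map ?N Y (\<lambda>z. snd z 1)" by (rule continuous_map_mapping_path_space_eval)
  fix n g h
  let ?T = "prod_topology (cube n) I01"
  assume "continuous_map (cube n) ?N g \<and> continuous_map ?T Y h \<and>
      (\<forall>x\<in>topspace (cube n). h (x, 0) = snd (g x) 1)"
  then have g: "continuous_map (cube n) ?N g" and h: "continuous_map ?T Y h"
    and hg: "\<And>x. x \<in> topspace (cube n) \<Longrightarrow> h (x, 0) = snd (g x) 1" by auto
  have gx: "snd (g x) \<in> paths_in Y" "snd (g x) 0 = f (fst (g x))" if "x \<in> topspace (cube n)" for x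
    using g that by (auto simp: continuous_map_def Pi_iff topspace_mapping_path_space)
  \<comment> \<open>At homotopy time \<open>s\<close> the extended path has length
    \<open>1 + s\<close>, and path time \<open>t\<close> corresponds to \<open>t * (1 + s)\<close>:
    the first unit runs through the old path, the rest through \<open>h\<close>. Clipping makes each
    branch continuous on the whole product.\<close>
  let ?p = "\<lambda>z :: ((nat \<Rightarrow> real) \<times> real) \<times> real. snd z * (1 + snd (fst z))"
  let ?F = "\<lambda>z. if ?p z \<le> 1 then snd (g (fst (fst z))) (min 1 (?p z))
      else h (fst (fst z), max 0 (?p z - 1))"
  have g2: "continuous_map (cube n) (compact_open_paths Y) (\<lambda>x. snd (g x))"
    using continuous_map_compose [OF g continuous_map_mapping_path_space(2)] by (simp add: o_def)
  have x: "continuous_map (prod_topology ?T I01) (cube n) (\<lambda>z. fst (fst z))"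
    using continuous_map_compose [OF continuous_map_fst continuous_map_fst] by (simp add: o_def)
  have "continuous_map (prod_topology ?T I01) I01 (\<lambda>z. snd (fst z))"
    using continuous_map_compose [OF continuous_map_fst continuous_map_snd] by (simp add: o_def)
  then have s: "continuous_map (prod_topology ?T I01) euclideanreal (\<lambda>z. snd (fst z))"
    by (simp add: continuous_map_in_subtopology)
  have t: "continuous_map (prod_topology ?T I01) euclideanreal snd"
    using continuous_map_snd [of ?T I01] by (simp add: continuous_map_in_subtopology)
  have p: "continuous_map (prod_topology ?T I01) euclideanreal ?p"
    using s t by (intro continuous_map_real_mult continuous_map_add) auto
  have p02: "0 \<le> ?p z" "?p z \<le> 2" if "z \<in> topspace (prod_topology ?T I01)" for z
  proof -
    have *: "0 \<le> snd z" "snd z \<le> 1" "0 \<le> snd (fst z)" "snd (fst z) \<le> 1" using that by auto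
    then show "0 \<le> ?p z" by simp
    have "?p z \<le> 1 * 2" using * by (intro mult_mono) auto
    then show "?p z \<le> 2" by simp
  qed
  have "continuous_map (prod_topology ?T I01) Y ?F"
  proof (rule continuous_map_cases_le [OF p])
    have "continuous_map (prod_topology ?T I01) (compact_open_paths Y) (\<lambda>z. snd (g (fst (fst z))))"
      using continuous_map_compose [OF x g2] by (simp add: o_def)
    moreover have "continuous_map (prod_topology ?T I01) I01 (\<lambda>z. min 1 (?p z))"
      unfolding continuous_map_in_subtopology using p02 p
      by (intro conjI continuous_map_real_min) auto
    ultimately have "continuous_map (prod_topology ?T I01) Y (\<lambda>z. snd (g (fst (fst z))) (min 1 (?p z)))"
      by (rule continuous_map_eval)
    then show "continuous_map (subtopology (prod_topology ?T I01)
        {z \<in> topspace (prod_topology ?T I01). ?p z \<le> 1}) Y (\<lambda>z. snd (g (fst (fst z))) (min 1 (?p z)))"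
      by (rule continuous_map_from_subtopology)
    have "continuous_map (prod_topology ?T I01) I01 (\<lambda>z. max 0 (?p z - 1))"
      unfolding continuous_map_in_subtopology
    proof
      show "continuous_map (prod_topology ?T I01) euclideanreal (\<lambda>z. max 0 (?p z - 1))"
        using p by (intro continuous_map_real_max continuous_map_diff) auto
      have "max 0 (?p z - 1) \<in> {0..1}" if "z \<in> topspace (prod_topology ?T I01)" for z
        using p02 [OF that] by simp
      then show "(\<lambda>z. max 0 (?p z - 1)) \<in> topspace (prod_topology ?T I01) \<rightarrow> {0..1}" by blast
    qed
    then have "continuous_map (prod_topology ?T I01) ?T (\<lambda>z. (fst (fst z), max 0 (?p z - 1)))"
      using x by (simp add: continuous_map_paired)
    from continuous_map_compose [OF this h]
    show "continuous_map (subtopology (prod_topology ?T I01)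
        {z \<in> topspace (prod_topology ?T I01). 1 \<le> ?p z}) Y (\<lambda>z. h (fst (fst z), max 0 (?p z - 1)))"
      by (simp add: o_def continuous_map_from_subtopology)
  next
    fix z assume "z \<in> topspace (prod_topology ?T I01)" and eq: "?p z = 1"
    then have "fst (fst z) \<in> topspace (cube n)" by auto
    then show "snd (g (fst (fst z))) (min 1 (?p z)) = h (fst (fst z), max 0 (?p z - 1))"
      unfolding eq by (simp add: hg)
  qed simp
  from continuous_map_curry [OF this]
  have c: "continuous_map ?T (compact_open_paths Y) (\<lambda>y. restrict (\<lambda>t. ?F (y, t)) {0..1})" .
  define k where "k = (\<lambda>y. (fst (g (fst y)), restrict (\<lambda>t. ?F (y, t)) {0..1}))"
  have "continuous_map ?T ?N k"
    unfolding continuous_map_into_mapping_path_space [OF Delta_generated_cube_cylinder]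
  proof (intro conjI ballI)
    show "continuous_map ?T V (\<lambda>y. fst (k y))"
      using continuous_map_compose [OF continuous_map_compose [OF continuous_map_fst g]
          continuous_map_mapping_path_space(1)] by (simp add: k_def o_def)
    show "continuous_map ?T (compact_open_paths Y) (\<lambda>y. snd (k y))"
      using c by (simp add: k_def)
    fix y assume "y \<in> topspace ?T"
    then have "fst y \<in> topspace (cube n)" by auto
    then show "snd (k y) 0 = f (fst (k y))" using gx by (simp add: k_def)
  qed
  moreover have "k (x, 0) = g x" if "x \<in> topspace (cube n)" for x
  proof -
    have "restrict (\<lambda>t. ?F ((x, 0), t)) {0..1} = snd (g x)"
      using paths_inD(2) [OF gx(1) [OF that]] by (auto simp: extensional_def fun_eq_iff)
    then show ?thesis unfolding k_def by (simp add: prod_eq_iff)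
  qed
  moreover have "snd (k y) 1 = h y" if "y \<in> topspace ?T" for y
    using that hg [of "fst y"] by (cases y) (auto simp: k_def)
  ultimately show "\<exists>k. continuous_map ?T ?N k \<and> (\<forall>x\<in>topspace (cube n). k (x, 0) = g x) \<and>
      (\<forall>z\<in>topspace ?T. snd (k z) 1 = h z)" by blast
qed

text \<open>The projection to \<open>V\<close> has the constant paths as homotopy inverse, and
  evaluation at 1 is homotopic to this projection followed by \<open>f\<close>.\<close>

lemma weak_homotopy_equivalence_mapping_path_space:
  assumes f: "weak_homotopy_equivalence V Y f" and V: "Delta_generated V"
  shows "weak_homotopy_equivalence (mapping_path_space V Y f) Y (\<lambda>z. snd z 1)"
proof -
  let ?N = "mapping_path_space V Y f"
  note cf = weak_homotopy_equivalence_continuous [OF f]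
  define \<sigma> where "\<sigma> = (\<lambda>v. (v, restrict (\<lambda>_ :: real. f v) {0..1}))"
  have "continuous_map (prod_topology V I01) Y (f \<circ> fst)"
    by (rule continuous_map_compose [OF continuous_map_fst cf])
  from continuous_map_curry [OF this]
  have \<sigma>: "continuous_map V ?N \<sigma>"
    unfolding continuous_map_into_mapping_path_space [OF V] \<sigma>_def by simp
  have fst: "weak_homotopy_equivalence ?N V fst"
  proof (rule weak_homotopy_equivalence_of_inverse [OF _ _ continuous_map_mapping_path_space(1) \<sigma>])
    show "weak_homotopy_equivalence V V (fst \<circ> \<sigma>)"
      by (rule weak_homotopy_equivalence_cong [OF weak_homotopy_equivalence_id]) (simp add: \<sigma>_def)
    show "weak_homotopy_equivalence ?N ?N (\<sigma> \<circ> fst)"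
    proof (rule weak_homotopy_equivalence_homotopic [OF weak_homotopy_equivalence_id])
      show "continuous_map ?N ?N (\<sigma> \<circ> fst)"
        by (rule continuous_map_compose [OF continuous_map_mapping_path_space(1) \<sigma>])
      \<comment> \<open>At time \<open>s\<close> only the portion of the path over
        \<open>[0, 1 - s]\<close> is kept, so each path contracts to its starting point.\<close>
      let ?H = "\<lambda>z s. (fst z, restrict (\<lambda>t. snd z (t * (1 - s))) {0..1})"
      show "cubewise_homotopy ?N ?N ?H (\<lambda>x. x) (\<sigma> \<circ> fst)"
        unfolding cubewise_homotopy_def
      proof (intro conjI allI impI ballI)
        fix n u assume u: "continuous_map (cube n) ?N u"
        let ?T = "prod_topology I01 (cube n)"
        have u1: "continuous_map (cube n) V (\<lambda>x. fst (u x))"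
          using continuous_map_compose [OF u continuous_map_mapping_path_space(1)] by (simp add: o_def)
        have u2: "continuous_map (cube n) (compact_open_paths Y) (\<lambda>x. snd (u x))"
          using continuous_map_compose [OF u continuous_map_mapping_path_space(2)] by (simp add: o_def)
        have x: "continuous_map (prod_topology ?T I01) (cube n) (\<lambda>z. snd (fst z))"
          using continuous_map_compose [OF continuous_map_fst continuous_map_snd] by (simp add: o_def)
        have p: "continuous_map (prod_topology ?T I01) (compact_open_paths Y) (\<lambda>z. snd (u (snd (fst z))))"
          using continuous_map_compose [OF x u2] by (simp add: o_def)
        have "continuous_map (prod_topology ?T I01) I01 (\<lambda>z. fst (fst z))"
          using continuous_map_compose [OF continuous_map_fst continuous_map_fst] by (simp add: o_def)
        then have s: "continuous_map (prod_topology ?T I01) euclideanreal (\<lambda>z. fst (fst z))"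
          by (simp add: continuous_map_in_subtopology)
        have t: "continuous_map (prod_topology ?T I01) euclideanreal snd"
          using continuous_map_snd [of ?T I01] by (simp add: continuous_map_in_subtopology)
        have "continuous_map (prod_topology ?T I01) I01 (\<lambda>z. snd z * (1 - fst (fst z)))"
          unfolding continuous_map_in_subtopology
        proof
          show "continuous_map (prod_topology ?T I01) euclideanreal (\<lambda>z. snd z * (1 - fst (fst z)))"
            using s t by (intro continuous_map_real_mult continuous_map_diff) auto
          have "snd z * (1 - fst (fst z)) \<in> {0..1}" if "z \<in> topspace (prod_topology ?T I01)" for z
            using that by (auto intro: mult_le_one)
          then show "(\<lambda>z. snd z * (1 - fst (fst z))) \<in> topspace (prod_topology ?T I01) \<rightarrow> {0..1}"
            by blast
        qed
        from continuous_map_eval [OF p this]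
        have e: "continuous_map (prod_topology ?T I01) Y
            (\<lambda>z. snd (u (snd (fst z))) (snd z * (1 - fst (fst z))))" .
        from continuous_map_curry [OF this]
        have "continuous_map ?T (compact_open_paths Y)
            (\<lambda>y. restrict (\<lambda>t. snd (u (snd y)) (t * (1 - fst y))) {0..1})" by simp
        moreover have "continuous_map ?T V (\<lambda>y. fst (u (snd y)))"
          using continuous_map_compose [OF continuous_map_snd u1] by (simp add: o_def)
        moreover have "snd (u x) 0 = f (fst (u x))" if "x \<in> topspace (cube n)" for x
          using u that by (auto simp: continuous_map_def Pi_iff topspace_mapping_path_space)
        ultimately have "continuous_map ?T ?N (\<lambda>y. ?H (u (snd y)) (fst y))"
          unfolding continuous_map_into_mapping_path_space [OF Delta_generated_cube_homotopy] by auto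
        then show "continuous_map ?T ?N (\<lambda>(s, x). ?H (u x) s)"
          by (simp add: case_prod_unfold)
      next
        fix z assume "z \<in> topspace ?N"
        then obtain v \<gamma> where z: "z = (v, \<gamma>)" and \<gamma>: "\<gamma> \<in> paths_in Y" "\<gamma> 0 = f v"
          by (auto simp: topspace_mapping_path_space)
        have "restrict \<gamma> {0..1} = \<gamma>"
          using paths_inD(2) [OF \<gamma>(1)] by (simp add: extensional_restrict)
        then show "?H z 0 = z" "?H z 1 = (\<sigma> \<circ> fst) z"
          using z \<gamma>(2) by (simp_all add: \<sigma>_def)
      qed
    qed
  qed
  show ?thesis
  proof (rule weak_homotopy_equivalence_homotopic [OF weak_homotopy_equivalence_compose [OF fst f]])
    show "continuous_map ?N Y (\<lambda>z. snd z 1)" by (rule continuous_map_mapping_path_space_eval)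
    \<comment> \<open>The path component is itself the homotopy: it starts at the image of the point
      under \<open>f\<close> and ends at its value at 1.\<close>
    show "cubewise_homotopy ?N Y snd (f \<circ> fst) (\<lambda>z. snd z 1)"
      unfolding cubewise_homotopy_def
    proof (intro conjI allI impI ballI)
      fix n u assume u: "continuous_map (cube n) ?N u"
      have "continuous_map (prod_topology I01 (cube n)) (compact_open_paths Y) (\<lambda>y. snd (u (snd y)))"
        using continuous_map_compose [OF continuous_map_compose [OF continuous_map_snd u]
            continuous_map_mapping_path_space(2)] by (simp add: o_def)
      from continuous_map_eval [OF this continuous_map_fst]
      show "continuous_map (prod_topology I01 (cube n)) Y (\<lambda>(t, x). snd (u x) t)"
        by (simp add: case_prod_unfold)
    qed (auto simp: topspace_mapping_path_space)
  qed
qed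

section \<open>Transport into the universe of points\<close>

text \<open>A homeomorphic copy on the image of an injective \<open>j\<close>. Cofibrancy and
  zigzags refer to fixed types of points, so the spaces constructed here must be copied into
  them.\<close>

definition transport_topology :: "('a \<Rightarrow> 'b) \<Rightarrow> 'a topology \<Rightarrow> 'b topology" where
  "transport_topology j X =
     pullback_topology (j ` topspace X) (inv_into (topspace X) j) X"

lemma homeomorphic_maps_transport:
  assumes j: "inj_on j (topspace X)"
  shows "homeomorphic_maps X (transport_topology j X) j (inv_into (topspace X) j)"
proof -
  have "continuous_map X X (inv_into (topspace X) j \<circ> j)"
    by (rule continuous_map_eq [OF continuous_map_id]) (use j in simp)
  then have "continuous_map X (transport_topology j X) j"
    unfolding transport_topology_def by (rule continuous_map_pullback') auto
  moreover have "continuous_map (transport_topology j X) X (inv_into (topspace X) j)"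
    unfolding transport_topology_def using continuous_map_pullback [OF continuous_map_id] by force
  moreover have "topspace (transport_topology j X) \<subseteq> j ` topspace X"
    by (auto simp: transport_topology_def topspace_pullback_topology)
  ultimately show ?thesis
    unfolding homeomorphic_maps_def using j by (auto simp: f_inv_into_f)
qed

lemma Delta_generated_transport:
  "inj_on j (topspace X) \<Longrightarrow> Delta_generated X \<Longrightarrow> Delta_generated (transport_topology j X)"
  by (rule Delta_generated_homeomorphic [OF homeomorphic_maps_transport])

lemma Serre_fibration_homeomorphic:
  assumes p: "Serre_fibration E B p"
    and jE: "homeomorphic_maps E E' jE iE" and jB: "homeomorphic_maps B B' jB iB"
  shows "Serre_fibration E' B' (jB \<circ> (p \<circ> iE))"
  unfolding Serre_fibration_def
proof (intro conjI allI impI)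
  have cp: "continuous_map E B p" using p by (simp add: Serre_fibration_def)
  have cont: "continuous_map E E' jE" "continuous_map E' E iE" "continuous_map B B' jB" "continuous_map B' B iB"
    using jE jB by (auto simp: homeomorphic_maps_def)
  have iE: "iE (jE x) = x" if "x \<in> topspace E" for x using jE that by (simp add: homeomorphic_maps_def)
  have jE': "jE (iE x) = x" if "x \<in> topspace E'" for x using jE that by (simp add: homeomorphic_maps_def)
  have iB: "iB (jB x) = x" if "x \<in> topspace B" for x using jB that by (simp add: homeomorphic_maps_def)
  have jB': "jB (iB x) = x" if "x \<in> topspace B'" for x using jB that by (simp add: homeomorphic_maps_def)
  show "continuous_map E' B' (jB \<circ> (p \<circ> iE))"
    using cp cont by (intro continuous_map_compose)
  fix n g h
  let ?T = "prod_topology (cube n) I01"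
  assume "continuous_map (cube n) E' g \<and> continuous_map ?T B' h \<and>
      (\<forall>x\<in>topspace (cube n). h (x, 0) = (jB \<circ> (p \<circ> iE)) (g x))"
  then have g: "continuous_map (cube n) E' g" and h: "continuous_map ?T B' h"
    and hg: "\<And>x. x \<in> topspace (cube n) \<Longrightarrow> h (x, 0) = jB (p (iE (g x)))" by auto
  have gx: "g x \<in> topspace E'" "iE (g x) \<in> topspace E" "p (iE (g x)) \<in> topspace B" if "x \<in> topspace (cube n)" for x
    using g cont(2) cp that by (auto simp: continuous_map_def Pi_iff)
  have "continuous_map (cube n) E (iE \<circ> g)" "continuous_map ?T B (iB \<circ> h)"
    using g h cont by (auto intro: continuous_map_compose)
  moreover have "\<forall>x\<in>topspace (cube n). (iB \<circ> h) (x, 0) = p ((iE \<circ> g) x)"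
    using hg iB gx by simp
  ultimately obtain k where k: "continuous_map ?T E k" "\<forall>x\<in>topspace (cube n). k (x, 0) = (iE \<circ> g) x"
      "\<forall>z\<in>topspace ?T. p (k z) = (iB \<circ> h) z"
    using p unfolding Serre_fibration_def by blast
  have "continuous_map ?T E' (jE \<circ> k)" by (rule continuous_map_compose [OF k(1) cont(1)])
  moreover have "\<forall>x\<in>topspace (cube n). (jE \<circ> k) (x, 0) = g x"
    using k(2) jE' gx by simp
  moreover have "(jB \<circ> (p \<circ> iE)) ((jE \<circ> k) z) = h z" if z: "z \<in> topspace ?T" for z
  proof -
    have "k z \<in> topspace E" "h z \<in> topspace B'" using k(1) h z by (auto simp: continuous_map_def)
    moreover have "p (k z) = iB (h z)" using bspec [OF k(3) z] by simp
    ultimately show ?thesis by (simp add: iE jB')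
  qed
  ultimately show "\<exists>k. continuous_map ?T E' k \<and> (\<forall>x\<in>topspace (cube n). k (x, 0) = g x) \<and>
      (\<forall>z\<in>topspace ?T. (jB \<circ> (p \<circ> iE)) (k z) = h z)" by blast
qed

definition transport_diagram :: "('a \<Rightarrow> 'b) \<Rightarrow> 'a diagram \<Rightarrow> 'b diagram" where
  "transport_diagram j D = Diagram (transport_topology j (vertex D))
     (\<lambda>\<phi> z. j (act D \<phi> (inv_into (topspace (vertex D)) j z)))"

lemma restrict_in_reparams:
  assumes "continuous_on {0..1} f" "mono_on {0..1} f" "f 0 = 0" "f 1 = 1"
  shows "restrict f {0..1} \<in> \<M>"
proof -
  have "continuous_on {0..1} (restrict f {0..1})"
    using assms(1) by (rule continuous_on_eq) simp
  then show ?thesis using assms by (auto simp: reparams_def mono_on_def)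
qed

lemma is_diagram_act_in:
  "is_diagram D \<Longrightarrow> \<phi> \<in> \<M> \<Longrightarrow> z \<in> topspace (vertex D) \<Longrightarrow> act D \<phi> z \<in> topspace (vertex D)"
  by (auto simp: is_diagram_def continuous_map_def)

lemma is_diagram_transport:
  assumes D: "is_diagram D" and j: "inj_on j (topspace (vertex D))"
  shows "is_diagram (transport_diagram j D)"
proof -
  let ?V = "vertex D" and ?V' = "transport_topology j (vertex D)"
  let ?i = "inv_into (topspace (vertex D)) j"
  note hom = homeomorphic_maps_transport [OF j]
  have cont: "continuous_map ?V ?V' j" "continuous_map ?V' ?V ?i"
    using hom by (auto simp: homeomorphic_maps_def)
  have i_in: "?i z \<in> topspace ?V" if "z \<in> topspace ?V'" for z
    using cont(2) that by (auto simp: continuous_map_def)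
  have ji: "j (?i z) = z" if "z \<in> topspace ?V'" for z
    using hom that by (simp add: homeomorphic_maps_def)
  have ij: "?i (j z) = z" if "z \<in> topspace ?V" for z
    using hom that by (simp add: homeomorphic_maps_def)
  have "continuous_map ?V' ?V' (\<lambda>z. j (act D \<phi> (?i z)))" if "\<phi> \<in> \<M>" for \<phi>
  proof -
    have "continuous_map ?V ?V (act D \<phi>)" using D that by (simp add: is_diagram_def)
    from continuous_map_compose [OF continuous_map_compose [OF cont(2) this] cont(1)]
    show ?thesis by (simp add: o_def)
  qed
  then show ?thesis
    using D i_in ji ij is_diagram_act_in [OF D] Delta_generated_transport [OF j]
    unfolding is_diagram_def transport_diagram_def by simp
qed

text \<open>The trivial fibration is conjugated by the copying homeomorphisms, the lift is taken
  inside \<open>'z univ\<close>, and the inverse homeomorphism brings it back to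
  \<open>E\<close>.\<close>

lemma projective_cofibrant_lift:
  fixes Z :: "'z diagram" and E :: "'e diagram" and B :: "'b diagram" and jE :: "'e \<Rightarrow> 'z univ" and jB :: "'b \<Rightarrow> 'z univ"
  assumes Z: "projective_cofibrant Z" and E: "is_diagram E" and B: "is_diagram B"
    and p: "projective_trivial_fibration E B p" and g: "diagram_map Z B g"
    and jE: "inj jE" and jB: "inj jB"
  obtains k where "diagram_map Z E k" "\<And>z. z \<in> topspace (vertex Z) \<Longrightarrow> p (k z) = g z"
proof -
  have jE: "inj_on jE (topspace (vertex E))" and jB: "inj_on jB (topspace (vertex B))"
    using jE jB by (auto intro: inj_on_subset)
  let ?E = "transport_diagram jE E" and ?B = "transport_diagram jB B"
  let ?iE = "inv_into (topspace (vertex E)) jE" and ?iB = "inv_into (topspace (vertex B)) jB"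
  note hE = homeomorphic_maps_transport [OF jE] and hB = homeomorphic_maps_transport [OF jB]
  have vE: "vertex ?E = transport_topology jE (vertex E)"
    and vB: "vertex ?B = transport_topology jB (vertex B)" by (simp_all add: transport_diagram_def)
  have cE: "continuous_map (vertex E) (vertex ?E) jE" "continuous_map (vertex ?E) (vertex E) ?iE"
    and cB: "continuous_map (vertex B) (vertex ?B) jB" "continuous_map (vertex ?B) (vertex B) ?iB"
    using hE hB unfolding vE vB by (auto simp: homeomorphic_maps_def)
  have ijE: "?iE (jE z) = z" if "z \<in> topspace (vertex E)" for z
    using hE that by (simp add: homeomorphic_maps_def)
  have ijB: "?iB (jB z) = z" if "z \<in> topspace (vertex B)" for z
    using hB that by (simp add: homeomorphic_maps_def)
  have iE_in: "?iE z \<in> topspace (vertex E)" if "z \<in> topspace (vertex ?E)" for z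
    using cE(2) that by (auto simp: continuous_map_def)
  let ?p = "jB \<circ> (p \<circ> ?iE)"
  have pE: "diagram_map E B p" and pw: "weak_homotopy_equivalence (vertex E) (vertex B) p"
    and pf: "Serre_fibration (vertex E) (vertex B) p"
    using p by (auto simp: projective_trivial_fibration_def)
  have cp: "continuous_map (vertex E) (vertex B) p" using pE by (simp add: diagram_map_def)
  have p_in: "p z \<in> topspace (vertex B)" if "z \<in> topspace (vertex E)" for z
    using cp that by (auto simp: continuous_map_def)
  have "diagram_map ?E ?B ?p"
    unfolding diagram_map_def
  proof (intro conjI ballI)
    show "continuous_map (vertex ?E) (vertex ?B) ?p"
      using cE cB cp by (intro continuous_map_compose)
    fix \<phi> z assume \<phi>: "\<phi> \<in> \<M>" and z: "z \<in> topspace (vertex ?E)"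
    then show "?p (act ?E \<phi> z) = act ?B \<phi> (?p z)"
      using pE iE_in [OF z] is_diagram_act_in [OF E \<phi>] p_in
      by (simp add: transport_diagram_def ijE ijB diagram_map_def)
  qed
  moreover have "weak_homotopy_equivalence (vertex ?E) (vertex ?B) ?p"
  proof -
    have "homeomorphic_maps (vertex ?E) (vertex E) ?iE jE"
      using homeomorphic_maps_sym [THEN iffD1, OF hE] unfolding vE .
    from weak_homotopy_equivalence_compose [OF weak_homotopy_equivalence_compose [OF
        weak_homotopy_equivalence_homeomorphic [OF this] pw] weak_homotopy_equivalence_homeomorphic [OF hB]]
    show ?thesis unfolding vB .
  qed
  moreover have "Serre_fibration (vertex ?E) (vertex ?B) ?p"
    unfolding vE vB by (rule Serre_fibration_homeomorphic [OF pf hE hB])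
  ultimately have "projective_trivial_fibration ?E ?B ?p"
    by (simp add: projective_trivial_fibration_def)
  moreover have "diagram_map Z ?B (jB \<circ> g)"
  proof -
    have "g z \<in> topspace (vertex B)" if "z \<in> topspace (vertex Z)" for z
      using g that by (auto simp: diagram_map_def continuous_map_def)
    then show ?thesis
      using g continuous_map_compose [OF _ cB(1), of "vertex Z" g]
      by (simp add: diagram_map_def transport_diagram_def ijB)
  qed
  moreover have "is_diagram ?E" "is_diagram ?B"
    using is_diagram_transport E B jE jB by blast+
  ultimately obtain k where k: "diagram_map Z ?E k" "\<forall>z\<in>topspace (vertex Z). ?p (k z) = (jB \<circ> g) z"
    using Z unfolding projective_cofibrant_def by blast
  have k_in: "k z \<in> topspace (vertex ?E)" if "z \<in> topspace (vertex Z)" for z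
    using k(1) that by (auto simp: diagram_map_def continuous_map_def)
  show ?thesis
  proof
    show "diagram_map Z E (?iE \<circ> k)"
      unfolding diagram_map_def
    proof (intro conjI ballI)
      show "continuous_map (vertex Z) (vertex E) (?iE \<circ> k)"
        using k(1) cE(2) by (auto simp: diagram_map_def intro: continuous_map_compose)
      fix \<phi> z assume \<phi>: "\<phi> \<in> \<M>" and z: "z \<in> topspace (vertex Z)"
      then have "k (act Z \<phi> z) = jE (act E \<phi> (?iE (k z)))"
        using k(1) by (simp add: diagram_map_def transport_diagram_def)
      then show "(?iE \<circ> k) (act Z \<phi> z) = act E \<phi> ((?iE \<circ> k) z)"
        using is_diagram_act_in [OF E \<phi> iE_in [OF k_in [OF z]]] by (simp add: ijE)
    qed
    fix z assume z: "z \<in> topspace (vertex Z)"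
    have gz: "g z \<in> topspace (vertex B)"
      using g z by (auto simp: diagram_map_def continuous_map_def)
    have "jB (p (?iE (k z))) = jB (g z)" using k(2) z by simp
    then show "p ((?iE \<circ> k) z) = g z"
      using ijB [OF gz] ijB [OF p_in [OF iE_in [OF k_in [OF z]]]] by simp
  qed
qed

lemma equivclp_span: "R z x \<Longrightarrow> R z y \<Longrightarrow> equivclp R x y"
  by (meson equivclp_sym equivclp_trans r_into_equivclp)

text \<open>A span is a zigzag of length two. Its apex must also have points in the universe built
  from \<open>W\<close> and \<open>D\<close>, which is what \<open>j\<close> provides.\<close>

lemma same_weak_homotopy_type_span:
  fixes Z :: "'z topology" and W :: "'w topology" and D :: "'d topology"
    and j :: "'z \<Rightarrow> ('w + 'd) univ"
  assumes f: "weak_homotopy_equivalence Z W f" and g: "weak_homotopy_equivalence Z D g"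
    and Z: "Delta_generated Z" and W: "Delta_generated W" and D: "Delta_generated D" and j: "inj j"
  shows "same_weak_homotopy_type W D"
proof -
  let ?jW = "\<lambda>w. Point (Inl w) :: ('w + 'd) univ" and ?jD = "\<lambda>d. Point (Inr d) :: ('w + 'd) univ"
  have inj: "inj_on j (topspace Z)" "inj_on ?jW (topspace W)" "inj_on ?jD (topspace D)"
    using j by (auto simp: inj_on_def)
  let ?Z = "transport_topology j Z" and ?W = "transport_topology ?jW W" and ?D = "transport_topology ?jD D"
  note hom = homeomorphic_maps_transport [OF inj(1)] homeomorphic_maps_transport [OF inj(2)]
    homeomorphic_maps_transport [OF inj(3)]
  let ?R = "\<lambda>A B. Delta_generated A \<and> Delta_generated B \<and> (\<exists>f. weak_homotopy_equivalence A B f)"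
  have Z': "weak_homotopy_equivalence ?Z Z (inv_into (topspace Z) j)"
    by (rule weak_homotopy_equivalence_homeomorphic [OF homeomorphic_maps_sym [THEN iffD1, OF hom(1)]])
  have DZ: "Delta_generated ?Z" and DW: "Delta_generated ?W" and DD: "Delta_generated ?D"
    using Delta_generated_transport inj Z W D by blast+
  have "weak_homotopy_equivalence ?Z ?W (?jW \<circ> (f \<circ> inv_into (topspace Z) j))"
    by (rule weak_homotopy_equivalence_compose [OF weak_homotopy_equivalence_compose [OF Z' f]
          weak_homotopy_equivalence_homeomorphic [OF hom(2)]])
  with DZ DW have "?R ?Z ?W" by blast
  moreover have "weak_homotopy_equivalence ?Z ?D (?jD \<circ> (g \<circ> inv_into (topspace Z) j))"
    by (rule weak_homotopy_equivalence_compose [OF weak_homotopy_equivalence_compose [OF Z' g]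
          weak_homotopy_equivalence_homeomorphic [OF hom(3)]])
  with DZ DD have "?R ?Z ?D" by blast
  ultimately have "equivclp ?R ?W ?D"
    by (rule equivclp_span)
  moreover have "W homeomorphic_space ?W" "D homeomorphic_space ?D"
    using hom unfolding homeomorphic_space_def by blast+
  ultimately show ?thesis
    unfolding same_weak_homotopy_type_def by blast
qed

section \<open>The monoid of reparametrizations\<close>

lemma reparamsD:
  assumes "\<phi> \<in> \<M>"
  shows "continuous_on {0..1} \<phi>" "mono_on {0..1} \<phi>" "\<phi> 0 = 0" "\<phi> 1 = 1" "\<phi> \<in> extensional {0..1}"
    "t \<in> {0..1} \<Longrightarrow> \<phi> t \<in> {0..1}"
proof -
  show \<phi>: "continuous_on {0..1} \<phi>" "mono_on {0..1} \<phi>" "\<phi> 0 = 0" "\<phi> 1 = 1" "\<phi> \<in> extensional {0..1}"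
    using assms by (auto simp: reparams_def)
  show "\<phi> t \<in> {0..1}" if "t \<in> {0..1}"
    using mono_onD [OF \<phi>(2), of 0 t] mono_onD [OF \<phi>(2), of t 1] \<phi>(3,4) that by auto
qed

lemma continuous_map_reparam: "\<phi> \<in> \<M> \<Longrightarrow> continuous_map I01 I01 \<phi>"
  using reparamsD(1,6) by (fastforce simp: continuous_map_in_subtopology)

text \<open>\<open>\<M>\<close> is convex; the segment from the identity to \<open>\<phi>\<close>
  will make reparametrization by \<open>\<phi>\<close> homotopic to the identity.\<close>

lemma interpolate_in_reparams:
  assumes \<phi>: "\<phi> \<in> \<M>" and s: "s \<in> {0..1}"
  shows "restrict (\<lambda>t. (1 - s) * t + s * \<phi> t) {0..1} \<in> \<M>"
proof (rule restrict_in_reparams)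
  show "continuous_on {0..1} (\<lambda>t. (1 - s) * t + s * \<phi> t)"
    by (intro continuous_intros reparamsD(1) \<phi>)
  show "mono_on {0..1} (\<lambda>t. (1 - s) * t + s * \<phi> t)"
    using mono_onD [OF reparamsD(2) [OF \<phi>]] s
    by (intro mono_onI add_mono mult_left_mono) auto
qed (simp_all add: reparamsD(3,4) [OF \<phi>])

text \<open>The map \<open>a\<close> of the overview: it runs through the interval on the left half
  and then waits at 1. The map \<open>b\<close>, called \<open>right_run\<close>, first waits at
  0.\<close>

definition left_run :: "real \<Rightarrow> real" where
  "left_run = restrict (\<lambda>t. min 1 (2 * t)) {0..1}"

definition right_run :: "real \<Rightarrow> real" where
  "right_run = restrict (\<lambda>t. max 0 (2 * t - 1)) {0..1}"

text \<open>
  This is \<open>\<phi>\<close> rescaled to the left half of the interval and the identity on the right half,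
  written without case distinction.
\<close>

definition squeeze :: "(real \<Rightarrow> real) \<Rightarrow> real \<Rightarrow> real" where
  "squeeze \<phi> = restrict (\<lambda>t. \<phi> (min 1 (2 * t)) / 2 + max 0 (t - 1/2)) {0..1}"

lemma left_run_in_reparams: "left_run \<in> \<M>"
  unfolding left_run_def
  by (rule restrict_in_reparams) (auto intro!: continuous_intros mono_onI)

lemma right_run_in_reparams: "right_run \<in> \<M>"
  unfolding right_run_def
  by (rule restrict_in_reparams) (auto intro!: continuous_intros mono_onI)

lemma squeeze_in_reparams:
  assumes \<phi>: "\<phi> \<in> \<M>"
  shows "squeeze \<phi> \<in> \<M>"
  unfolding squeeze_def
proof (rule restrict_in_reparams)
  have "continuous_on {0..1} (\<lambda>t. \<phi> (min 1 (2 * t)))"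
    by (rule continuous_on_compose2 [OF reparamsD(1) [OF \<phi>]]) (auto intro!: continuous_intros)
  then show "continuous_on {0..1} (\<lambda>t. \<phi> (min 1 (2 * t)) / 2 + max 0 (t - 1/2))"
    by (intro continuous_intros) auto
  show "mono_on {0..1} (\<lambda>t. \<phi> (min 1 (2 * t)) / 2 + max 0 (t - 1/2))"
    by (intro mono_onI add_mono divide_right_mono mono_onD [OF reparamsD(2) [OF \<phi>]]) auto
qed (simp_all add: reparamsD(3,4) [OF \<phi>])

lemma squeeze_apply:
  assumes "t \<in> {0..1}"
  shows "t \<le> 1/2 \<Longrightarrow> squeeze \<phi> t = \<phi> (2 * t) / 2"
    and "\<phi> \<in> \<M> \<Longrightarrow> 1/2 \<le> t \<Longrightarrow> squeeze \<phi> t = t"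
  using assms by (simp_all add: squeeze_def reparamsD(4))

lemma squeeze_id: "squeeze (restrict id {0..1}) = restrict id {0..1}"
  by (auto simp: squeeze_def fun_eq_iff min_def max_def)

text \<open>Squeezed maps preserve both halves of the interval, so composition can be computed on
  each half.\<close>

lemma squeeze_compose:
  assumes \<phi>: "\<phi> \<in> \<M>" and \<psi>: "\<psi> \<in> \<M>"
  shows "squeeze (compose {0..1} \<phi> \<psi>) = compose {0..1} (squeeze \<phi>) (squeeze \<psi>)"
proof
  fix t
  have \<phi>\<psi>: "compose {0..1} \<phi> \<psi> 1 = 1" by (simp add: compose_def reparamsD(4) \<phi> \<psi>)
  show "squeeze (compose {0..1} \<phi> \<psi>) t = compose {0..1} (squeeze \<phi>) (squeeze \<psi>) t"
  proof (cases "t \<in> {0..1}")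
    case t: True
    show ?thesis
    proof (cases "t \<le> 1/2")
      case True
      then have "\<psi> (2 * t) \<in> {0..1}" using reparamsD(6) [OF \<psi>, of "2 * t"] t by simp
      then show ?thesis using t True by (simp add: squeeze_apply compose_def)
    next
      case False
      then show ?thesis using t
        by (simp add: squeeze_apply(2) [OF _ \<phi>] squeeze_apply(2) [OF _ \<psi>] compose_def)
          (simp add: squeeze_def \<phi>\<psi> [unfolded compose_def, simplified])
    qed
  qed (auto simp: squeeze_def compose_def)
qed

text \<open>On the left half \<open>left_run\<close> undoes the rescaling by which
  \<open>\<phi>\<close> was squeezed; on the right half both sides are 1.\<close>

lemma compose_left_run_squeeze:
  assumes \<phi>: "\<phi> \<in> \<M>"
  shows "compose {0..1} left_run (squeeze \<phi>) = compose {0..1} \<phi> left_run"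
proof
  fix t
  show "compose {0..1} left_run (squeeze \<phi>) t = compose {0..1} \<phi> left_run t"
  proof (cases "t \<in> {0..1}")
    case t: True
    then have sq: "squeeze \<phi> t \<in> {0..1}" using reparamsD(6) [OF squeeze_in_reparams [OF \<phi>]] by blast
    show ?thesis
    proof (cases "t \<le> 1/2")
      case True
      then have "\<phi> (2 * t) \<in> {0..1}" using reparamsD(6) [OF \<phi>, of "2 * t"] t by simp
      then show ?thesis using t True sq by (simp add: squeeze_apply compose_def left_run_def)
    next
      case False
      then show ?thesis using t sq
        by (simp add: squeeze_apply(2) [OF _ \<phi>] compose_def left_run_def reparamsD(4) [OF \<phi>])
    qed
  qed (auto simp: compose_def)
qed

text \<open>\<open>right_run\<close> is 0 on the left half, which the squeezed map preserves, and
  the right half is left fixed pointwise.\<close>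

lemma compose_right_run_squeeze:
  assumes \<phi>: "\<phi> \<in> \<M>"
  shows "compose {0..1} right_run (squeeze \<phi>) = right_run"
proof
  fix t
  show "compose {0..1} right_run (squeeze \<phi>) t = right_run t"
  proof (cases "t \<in> {0..1}")
    case t: True
    then have sq: "squeeze \<phi> t \<in> {0..1}" using reparamsD(6) [OF squeeze_in_reparams [OF \<phi>]] by blast
    show ?thesis
    proof (cases "t \<le> 1/2")
      case True
      then have "\<phi> (2 * t) \<in> {0..1}" using reparamsD(6) [OF \<phi>, of "2 * t"] t by simp
      then show ?thesis using t True sq by (simp add: squeeze_apply compose_def right_run_def)
    next
      case False
      then show ?thesis using t by (simp add: squeeze_apply(2) [OF _ \<phi>] compose_def)
    qed
  qed (auto simp: compose_def right_run_def)
qed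

section \<open>Reparametrization of directed paths\<close>

lemma topspace_dpath_space: "dX \<subseteq> paths_in X \<Longrightarrow> topspace (dpath_space X dX) = dX"
  by (auto simp: dpath_space_def TOP_paths_def)

lemma Delta_generated_dpath_space: "Delta_generated (dpath_space X dX)"
  unfolding dpath_space_def by (rule Delta_generated_Delta_kelleyfication)

lemma continuous_map_into_dpath_space:
  assumes "Delta_generated T"
  shows "continuous_map T (dpath_space X dX) f \<longleftrightarrow>
    continuous_map T (compact_open_paths X) f \<and> f \<in> topspace T \<rightarrow> dX"
  using assms
  by (simp add: dpath_space_def TOP_paths_def continuous_map_into_Delta_kelleyfication
      continuous_map_in_subtopology)

lemma continuous_map_dpath_space: "continuous_map (dpath_space X dX) (compact_open_paths X) (\<lambda>\<gamma>. \<gamma>)"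
  unfolding dpath_space_def TOP_paths_def
  by (intro continuous_map_from_Delta_kelleyfication continuous_map_from_subtopology
      continuous_map_id_Delta_kelleyfication)

lemma continuous_map_precompose:
  assumes u: "continuous_map T (compact_open_paths X) u"
    and h: "continuous_map (prod_topology T I01) I01 h"
  shows "continuous_map T (compact_open_paths X) (\<lambda>x. restrict (\<lambda>t. u x (h (x, t))) {0..1})"
proof -
  have "continuous_map (prod_topology T I01) (compact_open_paths X) (\<lambda>z. u (fst z))"
    using continuous_map_compose [OF continuous_map_fst u] by (simp add: o_def)
  from continuous_map_curry [OF continuous_map_eval [OF this h]] show ?thesis by simp
qed

text \<open>The linear homotopy from the identity to \<open>\<phi>\<close> stays in
  \<open>\<M>\<close>, so invariance of \<open>dX\<close> keeps all intermediate reparametrized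
  paths in \<open>dX\<close>.\<close>

lemma weak_homotopy_equivalence_reparametrize:
  assumes dX: "dX \<subseteq> paths_in X"
    and inv: "\<And>\<gamma> \<phi>. \<gamma> \<in> dX \<Longrightarrow> \<phi> \<in> \<M> \<Longrightarrow> compose {0..1} \<gamma> \<phi> \<in> dX"
    and \<phi>: "\<phi> \<in> \<M>"
  shows "weak_homotopy_equivalence (dpath_space X dX) (dpath_space X dX) (\<lambda>\<gamma>. compose {0..1} \<gamma> \<phi>)"
proof (rule weak_homotopy_equivalence_homotopic [OF weak_homotopy_equivalence_id])
  let ?D = "dpath_space X dX"
  have "continuous_map (prod_topology ?D I01) I01 (\<lambda>z. \<phi> (snd z))"
    using continuous_map_compose [OF continuous_map_snd continuous_map_reparam [OF \<phi>]] by (simp add: o_def)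
  from continuous_map_precompose [OF continuous_map_dpath_space this]
  show "continuous_map ?D ?D (\<lambda>\<gamma>. compose {0..1} \<gamma> \<phi>)"
    unfolding continuous_map_into_dpath_space [OF Delta_generated_dpath_space]
    using inv [OF _ \<phi>] by (auto simp: topspace_dpath_space [OF dX] compose_def)
  let ?\<phi> = "\<lambda>s. restrict (\<lambda>t. (1 - s) * t + s * \<phi> t) {0..1}"
  show "cubewise_homotopy ?D ?D (\<lambda>\<gamma> s. compose {0..1} \<gamma> (?\<phi> s)) (\<lambda>\<gamma>. \<gamma>) (\<lambda>\<gamma>. compose {0..1} \<gamma> \<phi>)"
    unfolding cubewise_homotopy_def
  proof (intro conjI allI impI ballI)
    fix n u assume u: "continuous_map (cube n) ?D u"
    let ?T = "prod_topology I01 (cube n)"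
    have "continuous_map ?T (compact_open_paths X) (\<lambda>y. u (snd y))"
      using continuous_map_compose [OF continuous_map_compose [OF continuous_map_snd u]
          continuous_map_dpath_space] by (simp add: o_def)
    moreover have "continuous_map (prod_topology ?T I01) I01
        (\<lambda>z. (1 - fst (fst z)) * snd z + fst (fst z) * \<phi> (snd z))"
      unfolding continuous_map_in_subtopology
    proof
      have "continuous_map (prod_topology ?T I01) I01 (\<lambda>z. \<phi> (snd z))"
        using continuous_map_compose [OF continuous_map_snd continuous_map_reparam [OF \<phi>]]
        by (simp add: o_def)
      then have "continuous_map (prod_topology ?T I01) euclideanreal (\<lambda>z. \<phi> (snd z))"
        by (simp add: continuous_map_in_subtopology)
      moreover have "continuous_map (prod_topology ?T I01) I01 (\<lambda>z. fst (fst z))"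
        using continuous_map_compose [OF continuous_map_fst continuous_map_fst] by (simp add: o_def)
      then have "continuous_map (prod_topology ?T I01) euclideanreal (\<lambda>z. fst (fst z))"
        by (simp add: continuous_map_in_subtopology)
      moreover have "continuous_map (prod_topology ?T I01) euclideanreal snd"
        using continuous_map_snd [of ?T I01] by (simp add: continuous_map_in_subtopology)
      ultimately show "continuous_map (prod_topology ?T I01) euclideanreal
          (\<lambda>z. (1 - fst (fst z)) * snd z + fst (fst z) * \<phi> (snd z))"
        by (intro continuous_map_add continuous_map_real_mult continuous_map_diff) auto
      have "(1 - fst (fst z)) * snd z + fst (fst z) * \<phi> (snd z) \<in> {0..1}"
        if "z \<in> topspace (prod_topology ?T I01)" for z
        using that reparamsD(6) [OF interpolate_in_reparams [OF \<phi>, of "fst (fst z)"], of "snd z"] by auto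
      then show "(\<lambda>z. (1 - fst (fst z)) * snd z + fst (fst z) * \<phi> (snd z))
          \<in> topspace (prod_topology ?T I01) \<rightarrow> {0..1}" by blast
    qed
    ultimately have "continuous_map ?T (compact_open_paths X)
        (\<lambda>y. restrict (\<lambda>t. u (snd y) ((1 - fst y) * t + fst y * \<phi> t)) {0..1})"
      using continuous_map_precompose [where u = "\<lambda>y. u (snd y)" and T = ?T] by fastforce
    then have "continuous_map ?T (compact_open_paths X) (\<lambda>y. compose {0..1} (u (snd y)) (?\<phi> (fst y)))"
      by (rule continuous_map_eq) (auto simp: compose_def)
    moreover have "u (snd y) \<in> dX" if "y \<in> topspace ?T" for y
      using u that topspace_dpath_space [OF dX] by (auto simp: continuous_map_def)
    ultimately show "continuous_map ?T ?D (\<lambda>(s, x). compose {0..1} (u x) (?\<phi> s))"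
      unfolding continuous_map_into_dpath_space [OF Delta_generated_cube_homotopy]
      using inv interpolate_in_reparams [OF \<phi>] by (auto simp: case_prod_unfold)
  next
    fix \<gamma> assume "\<gamma> \<in> topspace ?D"
    then have "\<gamma> \<in> paths_in X" using dX topspace_dpath_space by blast
    then have "\<gamma> \<in> extensional {0..1}" by (rule paths_inD(2))
    then show "compose {0..1} \<gamma> (?\<phi> 0) = \<gamma>"
      by (auto simp: compose_def fun_eq_iff extensional_def)
    show "compose {0..1} \<gamma> (?\<phi> 1) = compose {0..1} \<gamma> \<phi>"
      by (auto simp: compose_def fun_eq_iff)
  qed
qed

section \<open>The colimit of a cofibrant diagram\<close>

text \<open>The restriction \<open>F\<^sup>*Z\<close> of the overview, with \<open>squeeze\<close>
  as \<open>F\<close>.\<close>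

definition squeezed_diagram :: "'z diagram \<Rightarrow> 'z diagram" where
  "squeezed_diagram Z = Diagram (vertex Z) (\<lambda>\<phi>. act Z (squeeze \<phi>))"

text \<open>The fibration replacement of \<open>b\<close>, viewed as a map from the constant diagram
  to \<open>squeezed_diagram Z\<close>. Hence the first component is not moved by the action, and
  the path is moved by the squeezed reparametrization.\<close>

definition contracting_diagram :: "'z diagram \<Rightarrow> ('z \<times> (real \<Rightarrow> 'z)) diagram" where
  "contracting_diagram Z = Diagram (mapping_path_space (vertex Z) (vertex Z) (act Z right_run))
     (\<lambda>\<phi> w. (fst w, restrict (act Z (squeeze \<phi>) \<circ> snd w) {0..1}))"

context
  fixes Z :: "'z diagram"
  assumes Z: "is_diagram Z"
begin

lemma act_in: "\<phi> \<in> \<M> \<Longrightarrow> z \<in> topspace (vertex Z) \<Longrightarrow> act Z \<phi> z \<in> topspace (vertex Z)"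
  by (rule is_diagram_act_in [OF Z])

lemma act_compose:
  "\<phi> \<in> \<M> \<Longrightarrow> \<psi> \<in> \<M> \<Longrightarrow> z \<in> topspace (vertex Z) \<Longrightarrow>
    act Z \<psi> (act Z \<phi> z) = act Z (compose {0..1} \<phi> \<psi>) z"
  using Z by (simp add: is_diagram_def)

lemma continuous_map_act: "\<phi> \<in> \<M> \<Longrightarrow> continuous_map (vertex Z) (vertex Z) (act Z \<phi>)"
  using Z by (simp add: is_diagram_def)

lemma act_squeeze_left_run:
  "\<phi> \<in> \<M> \<Longrightarrow> z \<in> topspace (vertex Z) \<Longrightarrow>
    act Z (squeeze \<phi>) (act Z left_run z) = act Z left_run (act Z \<phi> z)"
  by (simp add: act_compose squeeze_in_reparams left_run_in_reparams compose_left_run_squeeze)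

lemma act_squeeze_right_run:
  "\<phi> \<in> \<M> \<Longrightarrow> z \<in> topspace (vertex Z) \<Longrightarrow>
    act Z (squeeze \<phi>) (act Z right_run z) = act Z right_run z"
  by (simp add: act_compose squeeze_in_reparams right_run_in_reparams compose_right_run_squeeze)

lemma is_diagram_squeezed: "is_diagram (squeezed_diagram Z)"
  using Z squeeze_in_reparams unfolding is_diagram_def squeezed_diagram_def
  by (simp add: squeeze_id squeeze_compose)

lemma is_diagram_contracting: "is_diagram (contracting_diagram Z)"
proof -
  let ?V = "vertex Z"
  let ?N = "mapping_path_space ?V ?V (act Z right_run)"
  have "continuous_map ?N ?N (\<lambda>w. (fst w, restrict (act Z (squeeze \<phi>) \<circ> snd w) {0..1}))"
    if \<phi>: "\<phi> \<in> \<M>" for \<phi>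
    unfolding continuous_map_into_mapping_path_space [OF Delta_generated_mapping_path_space]
  proof (intro conjI ballI)
    show "continuous_map ?N ?V (\<lambda>w. fst (fst w, restrict (act Z (squeeze \<phi>) \<circ> snd w) {0..1}))"
      using continuous_map_mapping_path_space(1) by simp
    show "continuous_map ?N (compact_open_paths ?V)
        (\<lambda>w. snd (fst w, restrict (act Z (squeeze \<phi>) \<circ> snd w) {0..1}))"
      unfolding snd_conv
      by (rule continuous_map_postcompose [OF continuous_map_mapping_path_space(2)
            continuous_map_act [OF squeeze_in_reparams [OF \<phi>]]])
    \<comment> \<open>The moved path still starts where required, because squeezed maps fix every
      point of the form \<open>act Z right_run v\<close>.\<close>
    fix w assume "w \<in> topspace ?N"
    then show "snd (fst w, restrict (act Z (squeeze \<phi>) \<circ> snd w) {0..1}) 0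
        = act Z right_run (fst (fst w, restrict (act Z (squeeze \<phi>) \<circ> snd w) {0..1}))"
      using act_squeeze_right_run [OF \<phi>] by (auto simp: topspace_mapping_path_space)
  qed
  moreover have "act Z (restrict id {0..1}) z = z" if "z \<in> topspace ?V" for z
    using Z that by (simp add: is_diagram_def)
  note act_id = this
  have "restrict (act Z (squeeze (restrict id {0..1})) \<circ> snd w) {0..1} = snd w"
    if "w \<in> topspace ?N" for w
  proof
    fix t
    have w: "snd w \<in> paths_in ?V" using that by (auto simp: topspace_mapping_path_space)
    show "restrict (act Z (squeeze (restrict id {0..1})) \<circ> snd w) {0..1} t = snd w t"
    proof (cases "t \<in> {0..1}")
      case True
      then show ?thesis using act_id [OF paths_inD(3) [OF w True]] by (simp add: squeeze_id)
    next
      case False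
      then show ?thesis using paths_inD(2) [OF w] by (auto simp: extensional_def)
    qed
  qed
  moreover have "restrict (act Z (squeeze (compose {0..1} \<phi> \<psi>)) \<circ> snd w) {0..1}
      = restrict (act Z (squeeze \<psi>) \<circ> restrict (act Z (squeeze \<phi>) \<circ> snd w) {0..1}) {0..1}"
    if \<phi>: "\<phi> \<in> \<M>" and \<psi>: "\<psi> \<in> \<M>" and w: "w \<in> topspace ?N" for \<phi> \<psi> w
  proof
    fix t
    have "snd w \<in> paths_in ?V" using w by (auto simp: topspace_mapping_path_space)
    then have "snd w t \<in> topspace ?V" if "t \<in> {0..1}" using that by (rule paths_inD(3))
    then show "restrict (act Z (squeeze (compose {0..1} \<phi> \<psi>)) \<circ> snd w) {0..1} t
      = restrict (act Z (squeeze \<psi>) \<circ> restrict (act Z (squeeze \<phi>) \<circ> snd w) {0..1}) {0..1} t"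
      using act_compose [OF squeeze_in_reparams [OF \<phi>] squeeze_in_reparams [OF \<psi>]]
      by (simp add: squeeze_compose [OF \<phi> \<psi>])
  qed
  ultimately show ?thesis
    unfolding is_diagram_def contracting_diagram_def
    using Delta_generated_mapping_path_space by (simp add: prod_eq_iff)
qed

lemma projective_trivial_fibration_contracting:
  assumes w: "weak_homotopy_equivalence (vertex Z) (vertex Z) (act Z right_run)"
  shows "projective_trivial_fibration (contracting_diagram Z) (squeezed_diagram Z) (\<lambda>w. snd w 1)"
proof -
  have "Delta_generated (vertex Z)" using Z by (simp add: is_diagram_def)
  then show ?thesis
    using weak_homotopy_equivalence_mapping_path_space [OF w] Serre_fibration_mapping_path_space
      continuous_map_mapping_path_space_eval
    by (auto simp: projective_trivial_fibration_def diagram_map_def contracting_diagram_def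
        squeezed_diagram_def)
qed

lemma diagram_map_left_run: "diagram_map Z (squeezed_diagram Z) (act Z left_run)"
  using continuous_map_act [OF left_run_in_reparams] act_squeeze_left_run
  by (simp add: diagram_map_def squeezed_diagram_def)

lemma orbit_rel_act: "\<phi> \<in> \<M> \<Longrightarrow> z \<in> topspace (vertex Z) \<Longrightarrow> (z, act Z \<phi> z) \<in> orbit_rel Z"
  unfolding orbit_rel_def using act_in by (auto intro: r_into_equivclp)

lemma orbit_class_act:
  "\<phi> \<in> \<M> \<Longrightarrow> z \<in> topspace (vertex Z) \<Longrightarrow> orbit_rel Z `` {act Z \<phi> z} = orbit_rel Z `` {z}"
  using equiv_class_eq [OF equiv_orbit_rel orbit_rel_act] by metis

text \<open>Invariance under single elements of \<open>\<M>\<close> propagates along the zigzags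
  that generate the orbit relation; the universal property of the quotient does the rest.\<close>

lemma orbit_invariant_factors:
  assumes h: "\<And>\<phi> z. \<phi> \<in> \<M> \<Longrightarrow> z \<in> topspace (vertex Z) \<Longrightarrow> h (act Z \<phi> z) = h z"
    and c: "continuous_map (vertex Z) Y h"
  obtains h' where "continuous_map (colim Z) Y h'"
    "\<And>z. z \<in> topspace (vertex Z) \<Longrightarrow> h' (orbit_rel Z `` {z}) = h z"
proof (rule quotient_map_lift_exists [OF quotient_map_colim c])
  fix x y assume xy: "x \<in> topspace (vertex Z)" "y \<in> topspace (vertex Z)"
    and "orbit_rel Z `` {x} = orbit_rel Z `` {y}"
  then have "(x, y) \<in> orbit_rel Z" using eq_equiv_class_iff [OF equiv_orbit_rel] by metis
  then have "equivclp (\<lambda>z w. z \<in> topspace (vertex Z) \<and> (\<exists>\<phi>\<in>\<M>. w = act Z \<phi> z)) x y"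
    by (simp add: orbit_rel_def)
  then show "h x = h y"
    by (induction rule: equivclp_induct) (use h in auto)
qed (use that in blast)

lemma weak_homotopy_equivalence_colim:
  assumes cof: "projective_cofibrant Z"
    and weq: "\<And>\<phi>. \<phi> \<in> \<M> \<Longrightarrow> weak_homotopy_equivalence (vertex Z) (vertex Z) (act Z \<phi>)"
  shows "weak_homotopy_equivalence (vertex Z) (colim Z) (\<lambda>z. orbit_rel Z `` {z})"
proof -
  let ?V = "vertex Z" and ?W = "colim Z" and ?\<pi> = "\<lambda>z. orbit_rel Z `` {z}"
  have \<pi>: "quotient_map ?V ?W ?\<pi>" by (rule quotient_map_colim)
  then have c\<pi>: "continuous_map ?V ?W ?\<pi>" by (rule quotient_imp_continuous_map)
  \<comment> \<open>A pair is coded as a family indexed by the reals, with the point at index 0 and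
    the path at every other index.\<close>
  define jE :: "'z \<times> (real \<Rightarrow> 'z) \<Rightarrow> 'z univ" where
    "jE = (\<lambda>(z, \<gamma>). Family (\<lambda>t. if t = 0 then Point z else Family (\<lambda>s. Point (\<gamma> s))))"
  have "inj jE"
  proof (rule injI)
    fix v w assume eq: "jE v = jE w"
    obtain z \<gamma> z' \<gamma>' where vw: "v = (z, \<gamma>)" "w = (z', \<gamma>')" by (cases v; cases w)
    have fam: "(\<lambda>t. if t = (0::real) then Point z else Family (\<lambda>s. Point (\<gamma> s)))
        = (\<lambda>t. if t = 0 then Point z' else Family (\<lambda>s. Point (\<gamma>' s)))"
      using eq by (simp add: vw jE_def)
    have "z = z'" using fun_cong [OF fam, of 0] by simp
    moreover have "\<gamma> = \<gamma>'" using fun_cong [OF fam, of 1] by (auto simp: fun_eq_iff)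
    ultimately show "v = w" by (simp add: vw)
  qed
  moreover have "inj (Point :: 'z \<Rightarrow> 'z univ)" by (auto simp: inj_def)
  \<comment> \<open>The lift of \<open>left_run\<close> through evaluation at 1: the path in
    \<open>k z\<close> leads from \<open>right_run\<close> acting on the first component of
    \<open>k z\<close> to \<open>left_run\<close> acting on \<open>z\<close>.\<close>
  ultimately obtain k where k: "diagram_map Z (contracting_diagram Z) k"
    and k1: "\<And>z. z \<in> topspace ?V \<Longrightarrow> snd (k z) 1 = act Z left_run z"
    by (rule projective_cofibrant_lift [OF cof is_diagram_contracting is_diagram_squeezed
        projective_trivial_fibration_contracting [OF weq [OF right_run_in_reparams]]
        diagram_map_left_run]) (rule that)
  let ?N = "mapping_path_space ?V ?V (act Z right_run)"
  have ck: "continuous_map ?V ?N k"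
    using k by (simp add: diagram_map_def contracting_diagram_def)
  have k_act: "k (act Z \<phi> z) = (fst (k z), restrict (act Z (squeeze \<phi>) \<circ> snd (k z)) {0..1})"
    if "\<phi> \<in> \<M>" "z \<in> topspace ?V" for \<phi> z
    using k that by (simp add: diagram_map_def contracting_diagram_def)
  have k_in: "fst (k z) \<in> topspace ?V" "snd (k z) \<in> paths_in ?V"
    and k0: "snd (k z) 0 = act Z right_run (fst (k z))" if "z \<in> topspace ?V" for z
    using ck that by (auto simp: continuous_map_def Pi_iff topspace_mapping_path_space split_def)
  have ck1: "continuous_map ?V ?V (\<lambda>z. fst (k z))" and ck2: "continuous_map ?V (compact_open_paths ?V) (\<lambda>z. snd (k z))"
    using continuous_map_compose [OF ck continuous_map_mapping_path_space(1)]
      continuous_map_compose [OF ck continuous_map_mapping_path_space(2)] by (simp_all add: o_def)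
  \<comment> \<open>The action on \<open>contracting_diagram Z\<close> leaves first components
    alone, so equivariance of \<open>k\<close> makes its first component orbit-invariant.\<close>
  obtain r where r: "continuous_map ?W ?V r" "\<And>z. z \<in> topspace ?V \<Longrightarrow> r (?\<pi> z) = fst (k z)"
    by (rule orbit_invariant_factors [OF _ ck1]) (simp add: k_act, rule that)
  let ?h = "\<lambda>z. restrict (?\<pi> \<circ> snd (k z)) {0..1}"
  have ch: "continuous_map ?V (compact_open_paths ?W) ?h"
    by (rule continuous_map_postcompose [OF ck2 c\<pi>])
  \<comment> \<open>Equivariance moves the path by a squeezed map, which preserves orbits, so its
    image in the colimit is unchanged.\<close>
  have h_act: "?h (act Z \<phi> z) = ?h z" if \<phi>: "\<phi> \<in> \<M>" and z: "z \<in> topspace ?V" for \<phi> z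
  proof
    fix t show "?h (act Z \<phi> z) t = ?h z t"
      using k_act [OF \<phi> z] orbit_class_act [OF squeeze_in_reparams [OF \<phi>]] paths_inD(3) [OF k_in(2) [OF z]]
      by simp
  qed
  obtain H where H: "continuous_map ?W (compact_open_paths ?W) H"
      "\<And>z. z \<in> topspace ?V \<Longrightarrow> H (?\<pi> z) = ?h z"
    by (rule orbit_invariant_factors [OF _ ch]) (rule h_act, assumption+, rule that)
  have "weak_homotopy_equivalence ?W ?W (?\<pi> \<circ> r)"
  proof (rule weak_homotopy_equivalence_homotopic [OF weak_homotopy_equivalence_id])
    show "continuous_map ?W ?W (?\<pi> \<circ> r)" by (rule continuous_map_compose [OF r(1) c\<pi>])
    \<comment> \<open>In the colimit \<open>left_run\<close> and \<open>right_run\<close> act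
      trivially, so the path \<open>H c\<close> leads from \<open>?\<pi> (r c)\<close> to
      \<open>c\<close>; it is run backwards to start at the identity.\<close>
    show "cubewise_homotopy ?W ?W (\<lambda>c t. H c (1 - t)) (\<lambda>c. c) (?\<pi> \<circ> r)"
      unfolding cubewise_homotopy_def
    proof (intro conjI allI impI ballI)
      fix n u assume "continuous_map (cube n) ?W u"
      from continuous_map_compose [OF continuous_map_compose [OF continuous_map_snd this] H(1)]
      have "continuous_map (prod_topology I01 (cube n)) (compact_open_paths ?W) (\<lambda>y. H (u (snd y)))"
        by (simp add: o_def)
      moreover have "continuous_map (prod_topology I01 (cube n)) I01 (\<lambda>y. 1 - fst y)"
        using continuous_map_fst [of I01 "cube n"]
        by (auto simp: continuous_map_in_subtopology intro!: continuous_map_diff)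
      ultimately have "continuous_map (prod_topology I01 (cube n)) ?W (\<lambda>y. H (u (snd y)) (1 - fst y))"
        by (rule continuous_map_eval)
      then show "continuous_map (prod_topology I01 (cube n)) ?W (\<lambda>(t, x). H (u x) (1 - t))"
        by (simp add: case_prod_unfold)
    next
      fix c assume "c \<in> topspace ?W"
      then obtain z where z: "z \<in> topspace ?V" "c = ?\<pi> z"
        using quotient_imp_surjective_map [OF \<pi>] by auto
      show "H c (1 - 0) = c"
        using z H(2) k1 orbit_class_act [OF left_run_in_reparams z(1)] by simp
      show "H c (1 - 1) = (?\<pi> \<circ> r) c"
        using z H(2) k0 r(2) orbit_class_act [OF right_run_in_reparams k_in(1) [OF z(1)]] by simp
    qed
  qed
  \<comment> \<open>The reversed paths of \<open>k\<close> join the action of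
    \<open>left_run\<close> to \<open>act Z right_run \<circ> (r \<circ> ?\<pi>)\<close>, which is
    thus a weak equivalence; then the action of \<open>right_run\<close> is cancelled.\<close>
  moreover have "weak_homotopy_equivalence ?V ?V (r \<circ> ?\<pi>)"
  proof (rule weak_homotopy_equivalence_cancel_left [OF _ weq [OF right_run_in_reparams]])
    show "continuous_map ?V ?V (r \<circ> ?\<pi>)" by (rule continuous_map_compose [OF c\<pi> r(1)])
    note cr = continuous_map_compose [OF this continuous_map_act [OF right_run_in_reparams]]
    show "weak_homotopy_equivalence ?V ?V (act Z right_run \<circ> (r \<circ> ?\<pi>))"
    proof (rule weak_homotopy_equivalence_homotopic [OF weq [OF left_run_in_reparams] cr])
      show "cubewise_homotopy ?V ?V (\<lambda>z t. snd (k z) (1 - t)) (act Z left_run)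
          (act Z right_run \<circ> (r \<circ> ?\<pi>))"
        unfolding cubewise_homotopy_def
      proof (intro conjI allI impI ballI)
        fix n u assume "continuous_map (cube n) ?V u"
        from continuous_map_compose [OF continuous_map_compose [OF continuous_map_snd this] ck2]
        have "continuous_map (prod_topology I01 (cube n)) (compact_open_paths ?V) (\<lambda>y. snd (k (u (snd y))))"
          by (simp add: o_def)
        moreover have "continuous_map (prod_topology I01 (cube n)) I01 (\<lambda>y. 1 - fst y)"
          using continuous_map_fst [of I01 "cube n"]
          by (auto simp: continuous_map_in_subtopology intro!: continuous_map_diff)
        ultimately have "continuous_map (prod_topology I01 (cube n)) ?V (\<lambda>y. snd (k (u (snd y))) (1 - fst y))"
          by (rule continuous_map_eval)
        then show "continuous_map (prod_topology I01 (cube n)) ?V (\<lambda>(t, x). snd (k (u x)) (1 - t))"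
          by (simp add: case_prod_unfold)
      qed (simp_all add: k0 k1 r(2))
    qed
  qed
  ultimately show ?thesis
    by (intro weak_homotopy_equivalence_of_inverse [OF _ _ c\<pi> r(1)])
qed

end

section \<open>Conclusion for an arbitrary cofibrant replacement\<close>

theorem theorem8p2:
  fixes X :: "'a topology" and dX :: "(real \<Rightarrow> 'a) set" and H :: "'z set topology"
  assumes "Delta_generated X"
    and "dX \<subseteq> paths_in X"
    and "\<And>\<gamma> \<phi>. \<gamma> \<in> dX \<Longrightarrow> \<phi> \<in> \<M> \<Longrightarrow> compose {0..1} \<gamma> \<phi> \<in> dX"
    and "is_hocolim H (path_diagram X dX)"
  shows "same_weak_homotopy_type H (dpath_space X dX)"
proof -
  obtain Z :: "'z diagram" and q where cr: "cofibrant_replacement Z (path_diagram X dX) q"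
    and H: "H = colim Z"
    using assms(4) unfolding is_hocolim_def by blast
  have cof: "projective_cofibrant Z" and q: "diagram_map Z (path_diagram X dX) q"
    and wq: "weak_homotopy_equivalence (vertex Z) (dpath_space X dX) q"
    using cr by (simp_all add: cofibrant_replacement_def path_diagram_def)
  have Z: "is_diagram Z" using cof by (simp add: projective_cofibrant_def)
  \<comment> \<open>The map \<open>q\<close> intertwines the two actions, so the weak equivalence
    \<open>\<gamma> \<mapsto> \<gamma> \<circ> \<phi>\<close> on \<open>dX\<close> transfers to
    \<open>Z\<close> by cancelling \<open>q\<close>.\<close>
  have weq: "weak_homotopy_equivalence (vertex Z) (vertex Z) (act Z \<phi>)" if \<phi>: "\<phi> \<in> \<M>" for \<phi>
  proof (rule weak_homotopy_equivalence_cancel_left [OF _ wq continuous_map_act [OF Z \<phi>]])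
    show "weak_homotopy_equivalence (vertex Z) (dpath_space X dX) (q \<circ> act Z \<phi>)"
    proof (rule weak_homotopy_equivalence_cong)
      show "weak_homotopy_equivalence (vertex Z) (dpath_space X dX) ((\<lambda>\<gamma>. compose {0..1} \<gamma> \<phi>) \<circ> q)"
        by (rule weak_homotopy_equivalence_compose [OF wq
              weak_homotopy_equivalence_reparametrize [OF assms(2,3) \<phi>]])
    qed (use q \<phi> in \<open>simp add: diagram_map_def path_diagram_def\<close>)
  qed
  have DZ: "Delta_generated (vertex Z)" using Z by (simp add: is_diagram_def)
  \<comment> \<open>Points of the colimit are sets of points of \<open>Z\<close>, so singletons
    embed \<open>Z\<close> into the universe of the zigzag.\<close>
  have "inj (\<lambda>z :: 'z. Point (Inl {z}) :: ('z set + (real \<Rightarrow> 'a)) univ)"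
    by (auto simp: inj_def)
  from same_weak_homotopy_type_span [OF weak_homotopy_equivalence_colim [OF Z cof weq] wq DZ
      Delta_generated_quotient [OF quotient_map_colim DZ] Delta_generated_dpath_space this]
  show ?thesis unfolding H .
qed

end
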